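(* Let $k\ge 1$ be a constant integer, $0<\alpha\le 1$ a constant, $m=n^{\alpha}$, and let $\omega=\omega(n)$ be a real-valued function of $n$. For an integer $j\ge 1$ put $$ p_j=p_j(n)=\frac{\ln n+(j-1)\ln\ln n+\omega}{m}, $$ where $\omega$ is such that the probabilities $p_j$ used below lie in $[0,1]$. Then, as $n\to\infty$: (i) if $\omega\to-\infty$, then with probability tending to $1$ the random intersection graph $\mathcal{G}(n,m,p_1)$ is not $k$-connected; (ii) if $\omega\to\infty$, then with probability tending to $1$ the random intersection graph $\mathcal{G}(n,m,p_k)$ is $k$-connected; (i') if $\omega\to-\infty$, then with probability tending to $1$ the random intersection graph $\mathcal{G}(n,m,p_1)$ does not contain a Hamilton cycle; (ii') if $\omega\to\infty$, then with probability tending to $1$ the random intersection graph $\mathcal{G}(n,m,p_2)$ contains a Hamilton cycle.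
   Context: The random intersection graph $\mathcal{G}(n,m,p)$ is defined as follows. Let $\mathcal{V}$ be a set of $n$ vertices and $\mathcal{W}$ an auxiliary set of $m$ features. Each vertex $v\in\mathcal{V}$ is assigned a random subset $W_v\subseteq\mathcal{W}$, where each feature $w\in\mathcal{W}$ belongs to $W_v$ with probability $p$, independently over all pairs $(v,w)$. Two distinct vertices $v_1,v_2$ are adjacent if and only if $W_{v_1}\cap W_{v_2}\neq\emptyset$. All limits are taken as $n\to\infty$. "$k$-connected" means $k$-vertex-connected. *)

theory Defs
  imports "HOL-Probability.Probability" "Graph_Theory.Graph_Theory"
begin

text \<open>
  Vertices are \<open>0, \<dots>, n - 1\<close>, features are \<open>0, \<dots>, m - 1\<close>, and \<open>R (v, w)\<close> says that
  the feature \<open>w\<close> is assigned to the vertex \<open>v\<close>. As usual in the Graph_Theory library, an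
  undirected simple graph is a symmetric loop-free digraph without parallel arcs: each
  edge is represented by its two arcs.
\<close>

definition feature_set :: "nat \<Rightarrow> (nat \<times> nat \<Rightarrow> bool) \<Rightarrow> nat \<Rightarrow> nat set" where
  "feature_set m R v = {w. w < m \<and> R (v, w)}"

definition intersection_graph ::
    "nat \<Rightarrow> nat \<Rightarrow> (nat \<times> nat \<Rightarrow> bool) \<Rightarrow> nat pair_pre_digraph" where
  "intersection_graph n m R =
     \<lparr>pverts = {..<n},
      parcs = {(u, v). u < n \<and> v < n \<and> u \<noteq> v \<and>
                       feature_set m R u \<inter> feature_set m R v \<noteq> {}}\<rparr>"

text \<open>For \<open>p\<close> outside the unit interval, \<^const>\<open>bernoulli_pmf\<close> clamps its parameter.\<close>

definition random_intersection_graph ::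
    "nat \<Rightarrow> nat \<Rightarrow> real \<Rightarrow> nat pair_pre_digraph pmf" where
  "random_intersection_graph n m p =
     map_pmf (intersection_graph n m)
       (Pi_pmf ({..<n} \<times> {..<m}) False (\<lambda>_. bernoulli_pmf p))"

text \<open>
  \<open>k\<close>-vertex-connectivity: more than \<open>k\<close> vertices, and no set of fewer than \<open>k\<close> vertices
  whose removal disconnects the graph. The name \<open>connected\<close> is qualified because it
  would otherwise be ambiguous with the topological notion.
\<close>

definition k_connected :: "nat \<Rightarrow> ('a, 'b) pre_digraph \<Rightarrow> bool" where
  "k_connected k G \<longleftrightarrow>
     k < card (verts G) \<and>
     (\<forall>S \<subseteq> verts G. finite S \<and> card S < k \<longrightarrow>
        Digraph_Component.connected (induce_subgraph G (verts G - S)))"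

text \<open>
  The library's \<open>cycle\<close> also admits traversing an edge back and forth, a closed walk of
  length 2, which is not a cycle of the undirected graph. The vertices visited by a cycle
  are the tails of its arcs.
\<close>

definition has_hamilton_cycle :: "('a, 'b) pre_digraph \<Rightarrow> bool" where
  "has_hamilton_cycle G \<longleftrightarrow>
     (\<exists>c. pre_digraph.cycle G c \<and> 3 \<le> length c \<and> tail G ` set c = verts G)"

definition p_rig :: "(nat \<Rightarrow> real) \<Rightarrow> (nat \<Rightarrow> nat) \<Rightarrow> nat \<Rightarrow> nat \<Rightarrow> real" where
  "p_rig \<omega> m j n =
     (ln (real n) + (real j - 1) * ln (ln (real n)) + \<omega> n) / real (m n)"

end

theory Submission
  imports Defs "HOL-Real_Asymp.Real_Asymp"
begin

text \<open>
  Below the threshold the numbers of features of the vertices are independent, and a vertex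
  without features exists with probability tending to 1; such a vertex is isolated.

  Above the threshold the value \<open>p\<^sub>1\<close> already suffices, and \<open>p\<^sub>k \<ge> p\<^sub>1\<close> eventually. Put
  \<open>N = n p\<close>, which is at least \<open>m p \<ge> ln n + \<omega>\<close>. With probability tending to 1 every set of
  \<open>a \<le> c n\<close> vertices touches more than \<open>64 a / N\<close> features that contain at least \<open>N / 8\<close>
  vertices each; any \<open>f \<le> c' / p\<close> features of that size cover more than \<open>f N / 16\<close> vertices;
  and every set of more than \<open>c n\<close> vertices touches more than half of the features. So small sets
  \<open>A\<close> have at least \<open>2 |A| + k\<close> neighbours and two large sets always share a feature, which gives
  \<open>k\<close>-connectivity. For the Hamilton cycle, \<open>p\<close> is lowered by a constant multiple of \<open>1 / m\<close> and the missing
  incidences are added back in \<open>3 (n + 1)\<close> independent rounds. As long as there is no Hamilton cycle,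
  Posa's rotations yield linearly many start vertices \<open>v\<close> of longest paths, each with a linear-sized set of
  possible other ends; this set touches more than half of the features, so a positive fraction of all
  incidences closes a longest path, and each round lengthens the longest path with probability at least
  \<open>3/4\<close>.
\<close>


section \<open>Independent Bernoulli families\<close>

abbreviation bernoulli_family :: "'a set \<Rightarrow> real \<Rightarrow> ('a \<Rightarrow> bool) pmf" where
  "bernoulli_family A p \<equiv> Pi_pmf A False (\<lambda>_. bernoulli_pmf p)"

lemma prob_pmf_neg: "measure_pmf.prob M {x. \<not> P x} = 1 - measure_pmf.prob M {x. P x}"
proof -
  have "UNIV - {x. P x} = {x. \<not> P x}" by auto
  then show ?thesis using measure_pmf.prob_compl[of "{x. P x}" M] by simp
qed

text \<open>The supports are countable and carry all the mass, so intersecting both factors with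
  them reduces the claim to the product rule for countable sets.\<close>

lemma prob_pair_pmf_Times:
  "measure_pmf.prob (pair_pmf M N) (A \<times> B) = measure_pmf.prob M A * measure_pmf.prob N B"
proof -
  have "measure_pmf.prob (pair_pmf M N) (A \<times> B) =
        measure_pmf.prob (pair_pmf M N) ((A \<inter> set_pmf M) \<times> (B \<inter> set_pmf N))"
    by (intro measure_prob_cong_0) (auto simp: pmf_pair set_pmf_eq)
  also have "\<dots> = measure_pmf.prob M (A \<inter> set_pmf M) * measure_pmf.prob N (B \<inter> set_pmf N)"
    by (intro measure_pmf_prob_product) auto
  finally show ?thesis by (simp add: measure_Int_set_pmf)
qed

text \<open>Splitting the product over \<open>A\<close> into the coordinates inside and outside
  \<open>S\<close> makes \<open>P\<close> depend on the first factor alone and \<open>Q\<close> on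
  the second. Neither \<open>S\<close> nor \<open>T\<close> has to lie in \<open>A\<close>: off
  \<open>A\<close> every coordinate is almost surely \<open>d\<close>.\<close>

lemma prob_Pi_pmf_conj:
  assumes A: "finite A" and ST: "S \<inter> T = {}"
    and P: "\<And>R R'. (\<And>x. x \<in> S \<Longrightarrow> R x = R' x) \<Longrightarrow> P R = P R'"
    and Q: "\<And>R R'. (\<And>x. x \<in> T \<Longrightarrow> R x = R' x) \<Longrightarrow> Q R = Q R'"
  shows "measure_pmf.prob (Pi_pmf A d p) {R. P R \<and> Q R} =
         measure_pmf.prob (Pi_pmf A d p) {R. P R} * measure_pmf.prob (Pi_pmf A d p) {R. Q R}"
proof -
  let ?M = "Pi_pmf (A \<inter> S) d p" and ?N = "Pi_pmf (A - S) d p"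
  have eq: "Pi_pmf A d p = map_pmf (\<lambda>(f,g) x. if x \<in> A \<inter> S then f x else g x) (pair_pmf ?M ?N)"
    using Pi_pmf_union[of "A \<inter> S" "A - S" d p] A by (simp add: Int_Diff_Un Int_Diff_disjoint)
  \<comment> \<open>\<open>P\<close> may read coordinates of \<open>S\<close> outside
    \<open>A\<close>. There the combined function takes its value from \<open>g\<close>, so
    \<open>f\<close> and \<open>g\<close> must be known to agree at such points; both equal
    \<open>d\<close>.\<close>
  have out: "g x = d" if "x \<in> S" "g \<in> set_pmf ?N" for g x
    using set_Pi_pmf_subset[of "A - S" d p] A that by auto
  have out': "f x = d" if "x \<notin> A" "f \<in> set_pmf ?M" for f x
    using set_Pi_pmf_subset[of "A \<inter> S" d p] A that by auto
  have PP: "P (\<lambda>x. if x \<in> A \<inter> S then f x else g x) = P f"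
    if "f \<in> set_pmf ?M" "g \<in> set_pmf ?N" for f g
    using out[OF _ that(2)] out'[OF _ that(1)] by (intro P) auto
  have QQ: "Q (\<lambda>x. if x \<in> A \<inter> S then f x else g x) = Q g" for f g
    using ST by (intro Q) auto
  have ev: "measure_pmf.prob (Pi_pmf A d p) {R. E R} = measure_pmf.prob (pair_pmf ?M ?N) (X \<times> Y)"
    if "\<And>f g. f \<in> set_pmf ?M \<Longrightarrow> g \<in> set_pmf ?N \<Longrightarrow>
          E (\<lambda>x. if x \<in> A \<inter> S then f x else g x) \<longleftrightarrow> f \<in> X \<and> g \<in> Y" for E X Y
    unfolding eq measure_map_pmf
    by (intro measure_pmf.finite_measure_eq_AE AE_pmfI) (use that in auto)
  have "measure_pmf.prob (Pi_pmf A d p) {R. P R \<and> Q R} =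
        measure_pmf.prob (pair_pmf ?M ?N) ({f. P f} \<times> {g. Q g})"
    by (intro ev) (simp del: Int_iff add: PP QQ)
  moreover have "measure_pmf.prob (Pi_pmf A d p) {R. P R} =
        measure_pmf.prob (pair_pmf ?M ?N) ({f. P f} \<times> UNIV)"
    by (intro ev) (simp del: Int_iff add: PP)
  moreover have "measure_pmf.prob (Pi_pmf A d p) {R. Q R} =
        measure_pmf.prob (pair_pmf ?M ?N) (UNIV \<times> {g. Q g})"
    by (intro ev) (simp del: Int_iff add: QQ)
  ultimately show ?thesis by (simp add: prob_pair_pmf_Times)
qed

text \<open>Induction from the case of two events: the coordinates read by the remaining events form
  a union disjoint from \<open>S i\<close>.\<close>

lemma prob_Pi_pmf_ball:
  assumes A: "finite A" and I: "finite I"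
    and disj: "disjoint_family_on S I"
    and P: "\<And>i R R'. i \<in> I \<Longrightarrow> (\<And>x. x \<in> S i \<Longrightarrow> R x = R' x) \<Longrightarrow> P i R = P i R'"
  shows "measure_pmf.prob (Pi_pmf A d p) {R. \<forall>i\<in>I. P i R} =
         (\<Prod>i\<in>I. measure_pmf.prob (Pi_pmf A d p) {R. P i R})"
  using I disj P
proof (induction I rule: finite_induct)
  case (insert i I)
  have "measure_pmf.prob (Pi_pmf A d p) {R. P i R \<and> (\<forall>i\<in>I. P i R)} =
        measure_pmf.prob (Pi_pmf A d p) {R. P i R} * measure_pmf.prob (Pi_pmf A d p) {R. \<forall>i\<in>I. P i R}"
  proof (rule prob_Pi_pmf_conj[OF A, of "S i" "\<Union>j\<in>I. S j"])
    show "S i \<inter> (\<Union>j\<in>I. S j) = {}"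
      using insert.prems(1) insert.hyps by (auto simp: disjoint_family_on_def)
    show "P i R = P i R'" if "\<And>x. x \<in> S i \<Longrightarrow> R x = R' x" for R R'
      using insert.prems(2)[of i R R'] that by auto
    show "(\<forall>i\<in>I. P i R) = (\<forall>i\<in>I. P i R')" if "\<And>x. x \<in> (\<Union>j\<in>I. S j) \<Longrightarrow> R x = R' x" for R R'
    proof -
      have "P j R = P j R'" if "j \<in> I" for j
        using insert.prems(2)[of j R R'] that \<open>\<And>x. x \<in> (\<Union>j\<in>I. S j) \<Longrightarrow> R x = R' x\<close> by auto
      then show ?thesis by blast
    qed
  qed
  also have "measure_pmf.prob (Pi_pmf A d p) {R. \<forall>i\<in>I. P i R} =
        (\<Prod>i\<in>I. measure_pmf.prob (Pi_pmf A d p) {R. P i R})"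
  proof (rule insert.IH)
    show "disjoint_family_on S I"
      using insert.prems(1) by (rule disjoint_family_on_mono[rotated]) auto
    show "P i R = P i R'" if "i \<in> I" "\<And>x. x \<in> S i \<Longrightarrow> R x = R' x" for i R R'
      by (rule insert.prems(2)) (use that in auto)
  qed
  finally show ?case using insert.hyps by simp
qed simp

lemma prob_bernoulli_family_all_False:
  assumes "finite A" "X \<subseteq> A" "0 \<le> p" "p \<le> 1"
  shows "measure_pmf.prob (bernoulli_family A p) {R. \<forall>x\<in>X. \<not> R x} = (1 - p) ^ card X"
proof -
  have one: "measure_pmf.prob (bernoulli_family A p) {R. \<not> R x} = 1 - p" if "x \<in> A" for x
  proof -
    have "measure_pmf.prob (bernoulli_family A p) {R. \<not> R x} =
          measure_pmf.prob (map_pmf (\<lambda>f. f x) (bernoulli_family A p)) {False}"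
      by (simp add: vimage_def)
    also have "\<dots> = 1 - p"
      using that assms by (subst Pi_pmf_component) (auto simp: measure_pmf_single)
    finally show ?thesis .
  qed
  have "measure_pmf.prob (bernoulli_family A p) {R. \<forall>x\<in>X. \<not> R x} =
        (\<Prod>x\<in>X. measure_pmf.prob (bernoulli_family A p) {R. \<not> R x})"
    using assms(1,2) by (intro prob_Pi_pmf_ball[where S = "\<lambda>x. {x}"])
      (auto simp: disjoint_family_on_def intro: finite_subset)
  also have "\<dots> = (\<Prod>x\<in>X. 1 - p)" using assms by (intro prod.cong refl one) auto
  finally show ?thesis by simp
qed

text \<open>The power of \<open>t\<close> is a product with one factor per coordinate, so its
  expectation factorizes. This generating function is behind the Chernoff bounds below.\<close>

lemma expectation_bernoulli_family_power_card:
  assumes "finite A" "X \<subseteq> A" "0 \<le> p" "p \<le> 1" "0 \<le> t"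
  shows "measure_pmf.expectation (bernoulli_family A p) (\<lambda>R. t ^ card {x\<in>X. R x}) =
         (1 - p + p * t) ^ card X"
proof -
  have fX: "finite X" using assms finite_subset by blast
  have "(\<lambda>R. t ^ card {x\<in>X. R x}) = (\<lambda>R. \<Prod>x\<in>A. if x \<in> X \<and> R x then t else (1::real))"
  proof
    fix R
    have "(\<Prod>x\<in>A. if x \<in> X \<and> R x then t else (1::real)) = (\<Prod>x\<in>{x\<in>X. R x}. t)"
      using assms(1,2) by (intro prod.mono_neutral_cong_right) auto
    then show "t ^ card {x\<in>X. R x} = (\<Prod>x\<in>A. if x \<in> X \<and> R x then t else (1::real))" by simp
  qed
  then have "measure_pmf.expectation (bernoulli_family A p) (\<lambda>R. t ^ card {x\<in>X. R x}) =
    measure_pmf.expectation (bernoulli_family A p) (\<lambda>R. \<Prod>x\<in>A. (\<lambda>x b. if x \<in> X \<and> b then t else 1) x (R x))"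
    by simp
  also have "\<dots> = (\<Prod>x\<in>A. measure_pmf.expectation (bernoulli_pmf p) (\<lambda>b. if x \<in> X \<and> b then t else 1))"
    using assms by (subst expectation_prod_Pi_pmf) (auto intro: integrable_measure_pmf_finite)
  also have "\<dots> = (\<Prod>x\<in>A. if x \<in> X then 1 - p + p * t else 1)"
    using assms by (intro prod.cong) (auto simp: algebra_simps)
  also have "\<dots> = (\<Prod>x\<in>X. 1 - p + p * t)"
    using assms fX by (intro prod.mono_neutral_cong_right) auto
  finally show ?thesis by simp
qed

text \<open>An element is absent from two independent rounds with probability
  \<open>(1 - p) * (1 - q)\<close>, the complement of the combined parameter. All exposure in rounds
  rests on this identity.\<close>

lemma bernoulli_family_or:
  assumes A: "finite A" and p: "0 \<le> p" "p \<le> 1" and q: "0 \<le> q" "q \<le> 1"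
  shows "bernoulli_family A (p + q - p * q) =
         bind_pmf (bernoulli_family A p) (\<lambda>R. map_pmf (\<lambda>S x. R x \<or> S x) (bernoulli_family A q))"
proof -
  have pq: "0 \<le> p + q - p * q" "p + q - p * q \<le> 1"
  proof -
    have "p * q \<le> p" using p q by (simp add: mult_left_le)
    then show "0 \<le> p + q - p * q" using q by linarith
    have "(1 - p) * (1 - q) \<ge> 0" using p q by simp
    then show "p + q - p * q \<le> 1" by (simp add: algebra_simps)
  qed
  have b: "bernoulli_pmf (p + q - p * q) = bind_pmf (bernoulli_pmf p) (\<lambda>b. map_pmf (\<lambda>c. b \<or> c) (bernoulli_pmf q))"
  proof (rule pmf_eqI)
    fix i
    have "map_pmf ((\<or>) False) (bernoulli_pmf q) = map_pmf (\<lambda>c. c) (bernoulli_pmf q)"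
      by (intro map_pmf_cong) auto
    then have t: "map_pmf ((\<or>) False) (bernoulli_pmf q) = bernoulli_pmf q" by simp
    have "map_pmf ((\<or>) True) (bernoulli_pmf q) = map_pmf (\<lambda>c. True) (bernoulli_pmf q)"
      by (intro map_pmf_cong) auto
    then have u: "map_pmf ((\<or>) True) (bernoulli_pmf q) = return_pmf True" by simp
    show "pmf (bernoulli_pmf (p + q - p * q)) i =
         pmf (bind_pmf (bernoulli_pmf p) (\<lambda>b. map_pmf (\<lambda>c. b \<or> c) (bernoulli_pmf q))) i"
      using p q pq by (cases i) (simp_all add: pmf_bind t u algebra_simps)
  qed
  have "bernoulli_family A (p + q - p * q) =
        bind_pmf (bernoulli_family A p) (\<lambda>R. Pi_pmf A False (\<lambda>x. map_pmf (\<lambda>c. R x \<or> c) (bernoulli_pmf q)))"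
    unfolding b by (rule Pi_pmf_bind[OF A])
  also have "\<dots> = bind_pmf (bernoulli_family A p) (\<lambda>R. map_pmf (\<lambda>S x. R x \<or> S x) (bernoulli_family A q))"
  proof (intro bind_pmf_cong refl)
    fix R assume R: "R \<in> set_pmf (bernoulli_family A p)"
    have "Pi_pmf A False (\<lambda>x. map_pmf (\<lambda>c. R x \<or> c) (bernoulli_pmf q)) =
          Pi_pmf A False (\<lambda>x. bind_pmf (bernoulli_pmf q) (\<lambda>c. return_pmf (R x \<or> c)))"
      by (simp add: map_pmf_def)
    also have "\<dots> = bind_pmf (bernoulli_family A q) (\<lambda>S. return_pmf (\<lambda>x. if x \<in> A then R x \<or> S x else False))"
      using A by (subst Pi_pmf_bind[where d' = False]) simp_all
    also have "\<dots> = map_pmf (\<lambda>S x. R x \<or> S x) (bernoulli_family A q)"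
      unfolding map_pmf_def
    proof (intro bind_pmf_cong refl arg_cong[where f = return_pmf] ext)
      fix S x assume S: "S \<in> set_pmf (bernoulli_family A q)"
      show "(if x \<in> A then R x \<or> S x else False) = (R x \<or> S x)"
        using R S set_Pi_pmf_subset[OF A, of False] by auto
    qed
    finally show "Pi_pmf A False (\<lambda>x. map_pmf (\<lambda>c. R x \<or> c) (bernoulli_pmf q)) =
       map_pmf (\<lambda>S x. R x \<or> S x) (bernoulli_family A q)" .
  qed
  finally show ?thesis .
qed

lemma prob_bind_pmf:
  "measure_pmf.prob (bind_pmf M f) X = measure_pmf.expectation M (\<lambda>x. measure_pmf.prob (f x) X)"
  unfolding measure_pmf_bind
  by (subst measure_pmf.measure_bind[where N = "count_space UNIV"]) (auto simp: measure_subprob)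

lemma prob_bernoulli_family_or:
  assumes "finite A" "0 \<le> p" "p \<le> 1" "0 \<le> q" "q \<le> 1"
  shows "measure_pmf.prob (bernoulli_family A (p + q - p * q)) {R. P R} =
         measure_pmf.expectation (bernoulli_family A p)
           (\<lambda>R. measure_pmf.prob (bernoulli_family A q) {S. P (\<lambda>x. R x \<or> S x)})"
  unfolding bernoulli_family_or[OF assms]
  by (simp add: prob_bind_pmf vimage_def)

lemma expectation_pmf_le:
  fixes f g :: "'a \<Rightarrow> real"
  assumes "\<And>x. 0 \<le> f x" "\<And>x. f x \<le> g x" "\<And>x. g x \<le> B"
  shows "measure_pmf.expectation M f \<le> measure_pmf.expectation M g"
proof (rule integral_mono)
  have "\<bar>f x\<bar> \<le> B" "\<bar>g x\<bar> \<le> B" for x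
    using assms(1)[of x] assms(2)[of x] assms(3)[of x] by auto
  then show "integrable (measure_pmf M) f" "integrable (measure_pmf M) g"
    by (auto intro!: measure_pmf.integrable_const_bound[where B = B])
qed (use assms in auto)

text \<open>Coupling: for \<open>p < 1\<close> the family with parameter \<open>q\<close> is the one
  with parameter \<open>p\<close> joined with an independent one, whose parameter \<open>r\<close>
  solves \<open>p + r - p * r = q\<close>.\<close>

lemma prob_bernoulli_family_mono:
  assumes "finite A" "0 \<le> p" "p \<le> q" "q \<le> 1"
    and mono: "\<And>R S. P R \<Longrightarrow> P (\<lambda>x. R x \<or> S x)"
  shows "measure_pmf.prob (bernoulli_family A p) {R. P R} \<le> measure_pmf.prob (bernoulli_family A q) {R. P R}"
proof (cases "p = 1")
  case False
  define r where "r = (q - p) / (1 - p)"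
  have r: "0 \<le> r" "r \<le> 1" "q = p + r - p * r"
  proof -
    have "r * (1 - p) = q - p" using False by (simp add: r_def)
    then show "q = p + r - p * r" by (simp add: algebra_simps)
  qed (use assms False in \<open>auto simp: r_def\<close>)
  have "measure_pmf.prob (bernoulli_family A p) {R. P R} =
        measure_pmf.expectation (bernoulli_family A p) (\<lambda>R. indicator {R. P R} R)"
    by simp
  also have "\<dots> \<le> measure_pmf.expectation (bernoulli_family A p)
           (\<lambda>R. measure_pmf.prob (bernoulli_family A r) {S. P (\<lambda>x. R x \<or> S x)})"
    using mono by (intro expectation_pmf_le[where B = 1]) (auto simp: indicator_def)
  also have "\<dots> = measure_pmf.prob (bernoulli_family A q) {R. P R}"
    unfolding r(3) using assms r by (intro prob_bernoulli_family_or[symmetric]) auto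
  finally show ?thesis .
qed (use assms in auto)

section \<open>Rotations and longest paths\<close>

definition path_in :: "'a set \<Rightarrow> ('a \<Rightarrow> 'a \<Rightarrow> bool) \<Rightarrow> 'a list \<Rightarrow> bool" where
  "path_in V E xs \<longleftrightarrow> xs \<noteq> [] \<and> distinct xs \<and> set xs \<subseteq> V \<and> successively E xs"

text \<open>Edges are unordered pairs, so a segment keeps its edges when a rotation reverses
  it.\<close>

fun path_edges :: "'a list \<Rightarrow> 'a set set" where
  "path_edges (x # y # zs) = insert {x, y} (path_edges (y # zs))"
| "path_edges _ = {}"

lemma path_edges_append:
  "xs \<noteq> [] \<Longrightarrow> ys \<noteq> [] \<Longrightarrow>
   path_edges (xs @ ys) = path_edges xs \<union> {{last xs, hd ys}} \<union> path_edges ys"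
proof (induction xs rule: path_edges.induct)
  case ("2_2" x)
  then show ?case by (cases ys) auto
qed auto

lemma path_edges_rev: "path_edges (rev xs) = path_edges xs"
proof (induction xs rule: path_edges.induct)
  case (1 x y zs)
  have "path_edges (rev (x # y # zs)) = path_edges (rev (y # zs) @ [x])" by simp
  also have "\<dots> = path_edges (rev (y # zs)) \<union> {{y, x}}"
    by (subst path_edges_append) (auto simp: last_rev)
  finally show ?case using 1 by (auto simp: insert_commute)
qed auto

lemma path_edges_nth:
  "e \<in> path_edges xs \<Longrightarrow> \<exists>i. Suc i < length xs \<and> e = {xs ! i, xs ! Suc i}"
proof (induction xs rule: path_edges.induct)
  case (1 x y zs)
  show ?case
  proof (cases "e = {x, y}")
    case True
    then show ?thesis by (intro exI[of _ 0]) auto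
  next
    case False
    with 1 obtain i where "Suc i < length (y # zs)" "e = {(y # zs) ! i, (y # zs) ! Suc i}" by auto
    then show ?thesis by (intro exI[of _ "Suc i"]) auto
  qed
qed auto

lemma card_path_edges_nbrs:
  assumes "distinct xs"
  shows "finite {v. {v, u} \<in> path_edges xs} \<and> card {v. {v, u} \<in> path_edges xs} \<le> 2"
proof -
  have "\<exists>a b. {v. {v, u} \<in> path_edges xs} \<subseteq> {a, b}"
  proof (cases "u \<in> set xs")
    case True
    then obtain j where j: "j < length xs" "xs ! j = u" by (auto simp: in_set_conv_nth)
    \<comment> \<open>At an end of the list one candidate is not a neighbour (\<open>0 - 1\<close>
      is \<open>0\<close>, and \<open>Suc j\<close> may run past the end); this is harmless, since
      only an inclusion is claimed.\<close>
    have "v \<in> {xs ! Suc j, xs ! (j - 1)}" if e: "{v, u} \<in> path_edges xs" for v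
    proof -
      from path_edges_nth[OF e] obtain i where i: "Suc i < length xs" "{v, u} = {xs ! i, xs ! Suc i}"
        by blast
      then consider "v = xs ! i" "u = xs ! Suc i" | "v = xs ! Suc i" "u = xs ! i"
        by (auto simp: doubleton_eq_iff)
      then show ?thesis
      proof cases
        case 1
        then have "j = Suc i" using j i assms nth_eq_iff_index_eq by metis
        then show ?thesis using 1 by simp
      next
        case 2
        then have "j = i" using j i assms nth_eq_iff_index_eq Suc_lessD by metis
        then show ?thesis using 2 by simp
      qed
    qed
    then show ?thesis by blast
  next
    case False
    have "{v, u} \<notin> path_edges xs" for v
    proof
      assume "{v, u} \<in> path_edges xs"
      from path_edges_nth[OF this] obtain i where "Suc i < length xs" "{v, u} = {xs ! i, xs ! Suc i}"
        by blast
      then have "u \<in> set xs" by (metis Suc_lessD doubleton_eq_iff nth_mem)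
      with False show False by simp
    qed
    then show ?thesis by blast
  qed
  then obtain a b where ab: "{v. {v, u} \<in> path_edges xs} \<subseteq> {a, b}" by blast
  then have "card {v. {v, u} \<in> path_edges xs} \<le> card {a, b}" by (intro card_mono) auto
  also have "\<dots> \<le> 2" by (simp add: card_insert_if)
  finally show ?thesis using ab finite_subset by blast
qed

lemma successively_rev_symp:
  assumes "symp E"
  shows "successively E (rev xs) \<longleftrightarrow> successively E xs"
proof -
  have "(\<lambda>x y. E y x) = E" using assms by (auto simp: symp_def fun_eq_iff)
  then show ?thesis by (simp only: successively_rev)
qed

text \<open>Posa's rotation with the first vertex held fixed: the edge from \<open>v\<close> to
  \<open>hd bs\<close> is exchanged for the one from \<open>v\<close> to \<open>last bs\<close>, and
  \<open>hd bs\<close> becomes the new last vertex.\<close>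

inductive rotation :: "('a \<Rightarrow> 'a \<Rightarrow> bool) \<Rightarrow> 'a list \<Rightarrow> 'a list \<Rightarrow> bool" for E xs where
  start: "rotation E xs xs"
| rotate: "rotation E xs (as @ v # bs) \<Longrightarrow> bs \<noteq> [] \<Longrightarrow> E (last bs) v \<Longrightarrow>
           rotation E xs (as @ v # rev bs)"

definition rotation_ends :: "('a \<Rightarrow> 'a \<Rightarrow> bool) \<Rightarrow> 'a list \<Rightarrow> 'a set" where
  "rotation_ends E xs = {last ys |ys. rotation E xs ys}"

lemma rotation_path:
  assumes "rotation E xs ys" "symp E" "path_in V E xs"
  shows "path_in V E ys \<and> set ys = set xs \<and> hd ys = hd xs \<and> length ys = length xs"
  using assms
proof (induction rule: rotation.induct)
  case (rotate as v bs)
  then have IH: "path_in V E (as @ v # bs)" "set (as @ v # bs) = set xs"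
    "hd (as @ v # bs) = hd xs" "length (as @ v # bs) = length xs" by auto
  have "successively E (as @ v # rev bs)"
    using IH(1) rotate.hyps rotate.prems(1)
    by (auto simp: path_in_def successively_append_iff successively_Cons hd_rev
        successively_rev_symp[OF rotate.prems(1)] sympD[OF rotate.prems(1)] simp del: successively_rev)
  then have "path_in V E (as @ v # rev bs)" using IH(1) by (auto simp: path_in_def)
  then show ?case using IH by (cases as) auto
qed auto

text \<open>The only edge added by a rotation at \<open>w\<close> is \<open>{w, last bs}\<close>,
  and both \<open>hd bs\<close> and \<open>last bs\<close> are ends of rotated paths. If the new
  edge contains \<open>v\<close>, then \<open>v = w\<close>, so the removed edge
  \<open>{v, hd bs}\<close> was by induction an edge of \<open>xs\<close> from \<open>v\<close> to
  an end, which is excluded.\<close>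

lemma rotation_preserves_edges:
  assumes "rotation E xs ys" "v \<notin> rotation_ends E xs"
    and "\<And>u. {v, u} \<in> path_edges xs \<Longrightarrow> u \<notin> rotation_ends E xs"
    and "{v, u} \<in> path_edges ys"
  shows "{v, u} \<in> path_edges xs"
  using assms(1,4)
proof (induction arbitrary: u rule: rotation.induct)
  case (rotate as w bs)
  have r: "rotation E xs (as @ w # rev bs)" by (rule rotation.rotate) fact+
  have "last (as @ w # rev bs) \<in> rotation_ends E xs" "last (as @ w # bs) \<in> rotation_ends E xs"
    unfolding rotation_ends_def using r rotate.hyps(1) by blast+
  then have ends: "hd bs \<in> rotation_ends E xs" "last bs \<in> rotation_ends E xs"
    using rotate.hyps(2) by (auto simp: last_rev)
  have old: "path_edges (as @ w # bs) = path_edges (as @ [w]) \<union> {{w, hd bs}} \<union> path_edges bs"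
    using path_edges_append[of "as @ [w]" bs] rotate.hyps(2) by simp
  have new: "path_edges (as @ w # rev bs) = path_edges (as @ [w]) \<union> {{w, last bs}} \<union> path_edges bs"
    using path_edges_append[of "as @ [w]" "rev bs"] rotate.hyps(2) by (simp add: path_edges_rev hd_rev)
  show ?case
  proof (cases "{v, u} = {w, last bs}")
    case True
    then have "v = w" using assms(2) ends by (auto simp: doubleton_eq_iff)
    then have "{v, hd bs} \<in> path_edges xs" by (intro rotate.IH) (simp add: old)
    then show ?thesis using assms(3) ends by blast
  next
    case False
    then show ?thesis using rotate.prems by (intro rotate.IH) (auto simp: old new)
  qed
qed simp

lemma rotation_ends_subset:
  assumes "symp E" "path_in V E xs"
  shows "rotation_ends E xs \<subseteq> set xs"
  using rotation_path[OF _ assms] unfolding rotation_ends_def path_in_def by (fastforce)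

text \<open>Posa's lemma. Let \<open>ys\<close> be a rotated path ending in \<open>b\<close>; by
  maximality it contains \<open>v\<close>. Rotating at \<open>v\<close> makes the successor of
  \<open>v\<close> on \<open>ys\<close> an end. If \<open>v\<close> had no end next to it on
  \<open>xs\<close>, the edge to this successor would already be an edge of \<open>xs\<close>, a
  contradiction.\<close>

lemma rotation_ends_nbr:
  assumes sym: "symp E" and xs: "path_in V E xs"
    and longest: "\<And>ys. path_in V E ys \<Longrightarrow> length ys \<le> length xs"
    and b: "b \<in> rotation_ends E xs" and v: "E b v" "v \<in> V" "v \<notin> rotation_ends E xs"
  shows "\<exists>u\<in>rotation_ends E xs. {v, u} \<in> path_edges xs"
proof (rule ccontr)
  assume contra: "\<not> ?thesis"
  from b obtain ys where ys: "rotation E xs ys" "last ys = b" by (auto simp: rotation_ends_def)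
  note p = rotation_path[OF ys(1) sym xs]
  have "v \<in> set ys"
  proof (rule ccontr)
    assume "v \<notin> set ys"
    then have "path_in V E (ys @ [v])"
      using p v ys(2) by (auto simp: path_in_def successively_append_iff)
    from longest[OF this] show False using p by simp
  qed
  then obtain as bs where split: "ys = as @ v # bs" by (auto simp: in_set_conv_decomp)
  have bs: "bs \<noteq> []" using split ys(2) b v(3) by auto
  then have "E (last bs) v" using split ys(2) v(1) by simp
  with bs ys(1) have r: "rotation E xs (as @ v # rev bs)" unfolding split by (intro rotation.rotate)
  then have "last (as @ v # rev bs) \<in> rotation_ends E xs" unfolding rotation_ends_def by blast
  then have "hd bs \<in> rotation_ends E xs" using bs by (simp add: last_rev)
  moreover have "{v, hd bs} \<in> path_edges ys"
    using path_edges_append[of "as @ [v]" bs] bs split by simp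
  then have "{v, hd bs} \<in> path_edges xs"
    using contra by (intro rotation_preserves_edges[OF ys(1) v(3)]) auto
  ultimately show False using contra by blast
qed

text \<open>Every neighbour outside the set of ends is next to an end on \<open>xs\<close>, and each
  vertex has at most two neighbours on a path. So the set of ends has at most twice as many outside
  neighbours as elements and violates the expansion unless it is larger than
  \<open>s\<close>.\<close>

lemma card_rotation_ends:
  fixes s :: real
  assumes V: "finite V" and sym: "symp E" and xs: "path_in V E xs"
    and longest: "\<And>ys. path_in V E ys \<Longrightarrow> length ys \<le> length xs"
    and expand: "\<And>A. A \<subseteq> V \<Longrightarrow> A \<noteq> {} \<Longrightarrow> real (card A) \<le> s \<Longrightarrow>
                   2 * card A < card ({v \<in> V. \<exists>u\<in>A. E u v} - A)"
  shows "s < real (card (rotation_ends E xs))"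
proof (rule ccontr)
  let ?S = "rotation_ends E xs"
  assume "\<not> s < real (card ?S)"
  moreover have S: "?S \<subseteq> V" using rotation_ends_subset[OF sym xs] xs by (auto simp: path_in_def)
  moreover have "last xs \<in> ?S" unfolding rotation_ends_def by (auto intro: rotation.start)
  ultimately have "2 * card ?S < card ({v \<in> V. \<exists>u\<in>?S. E u v} - ?S)"
    by (intro expand) auto
  also have fS: "finite ?S" using S V finite_subset by blast
  have d: "distinct xs" using xs by (simp add: path_in_def)
  have "card ({v \<in> V. \<exists>u\<in>?S. E u v} - ?S) \<le> card (\<Union>u\<in>?S. {v. {v, u} \<in> path_edges xs})"
  proof (rule card_mono)
    show "finite (\<Union>u\<in>?S. {v. {v, u} \<in> path_edges xs})"
      using fS card_path_edges_nbrs[OF d] by blast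
    show "{v \<in> V. \<exists>u\<in>?S. E u v} - ?S \<subseteq> (\<Union>u\<in>?S. {v. {v, u} \<in> path_edges xs})"
      using rotation_ends_nbr[OF sym xs longest] by blast
  qed
  also have "\<dots> \<le> (\<Sum>u\<in>?S. card {v. {v, u} \<in> path_edges xs})" by (rule card_UN_le[OF fS])
  also have "\<dots> \<le> (\<Sum>u\<in>?S. 2)" by (intro sum_mono) (use card_path_edges_nbrs[OF d] in blast)
  finally show False by simp
qed

section \<open>Hamilton cycles, longest paths and the deficit\<close>

definition hamiltonian :: "'a set \<Rightarrow> ('a \<Rightarrow> 'a \<Rightarrow> bool) \<Rightarrow> bool" where
  "hamiltonian V E \<longleftrightarrow>
     (\<exists>xs. path_in V E xs \<and> set xs = V \<and> 3 \<le> length xs \<and> E (last xs) (hd xs))"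

definition longest_path :: "'a set \<Rightarrow> ('a \<Rightarrow> 'a \<Rightarrow> bool) \<Rightarrow> nat" where
  "longest_path V E = Max (length ` {xs. path_in V E xs})"

text \<open>The cut form of connectivity directly supplies an edge leaving the vertex set of a cycle
  that is not spanning.\<close>

definition connected_on :: "'a set \<Rightarrow> ('a \<Rightarrow> 'a \<Rightarrow> bool) \<Rightarrow> bool" where
  "connected_on V E \<longleftrightarrow> (\<forall>A\<subseteq>V. A \<noteq> {} \<and> A \<noteq> V \<longrightarrow> (\<exists>a\<in>A. \<exists>b\<in>V - A. E a b))"

text \<open>Potential function for the sprinkling: it vanishes exactly for Hamiltonian graphs. The
  successor keeps it positive when there is a spanning path but no Hamilton cycle.\<close>

definition hamilton_deficit :: "'a set \<Rightarrow> ('a \<Rightarrow> 'a \<Rightarrow> bool) \<Rightarrow> nat" where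
  "hamilton_deficit V E = (if hamiltonian V E then 0 else Suc (card V) - longest_path V E)"

lemma finite_path_in: "finite V \<Longrightarrow> finite {xs. path_in V E xs}"
  by (rule finite_subset[OF _ finite_subset_distinct[of V]]) (auto simp: path_in_def)

lemma length_le_longest_path: "finite V \<Longrightarrow> path_in V E xs \<Longrightarrow> length xs \<le> longest_path V E"
  unfolding longest_path_def by (intro Max_ge finite_imageI finite_path_in) auto

lemma ex_longest_path:
  assumes "finite V" "V \<noteq> {}"
  obtains xs where "path_in V E xs" "length xs = longest_path V E"
proof -
  from assms(2) obtain v where "v \<in> V" by blast
  then have "path_in V E [v]" by (simp add: path_in_def)
  then have "Max (length ` {xs. path_in V E xs}) \<in> length ` {xs. path_in V E xs}"
    using finite_path_in[OF assms(1)] by (intro Max_in) auto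
  then show thesis using that by (auto simp: longest_path_def)
qed

lemma longest_path_le_card:
  assumes "finite V" "V \<noteq> {}"
  shows "longest_path V E \<le> card V"
proof -
  obtain xs where "path_in V E xs" "length xs = longest_path V E" using ex_longest_path[OF assms] .
  then show ?thesis using assms card_mono[of V "set xs"] by (auto simp: path_in_def distinct_card)
qed

lemma path_in_mono: "path_in V E xs \<Longrightarrow> (\<And>u v. E u v \<Longrightarrow> E' u v) \<Longrightarrow> path_in V E' xs"
  by (auto simp: path_in_def intro: successively_mono)

lemma hamiltonian_mono: "hamiltonian V E \<Longrightarrow> (\<And>u v. E u v \<Longrightarrow> E' u v) \<Longrightarrow> hamiltonian V E'"
  unfolding hamiltonian_def using path_in_mono by metis

lemma longest_path_mono:
  assumes "finite V" "V \<noteq> {}" "\<And>u v. E u v \<Longrightarrow> E' u v"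
  shows "longest_path V E \<le> longest_path V E'"
proof -
  obtain xs where "path_in V E xs" "length xs = longest_path V E" using ex_longest_path[OF assms(1,2)] .
  then show ?thesis using length_le_longest_path[OF assms(1) path_in_mono] assms(3) by metis
qed

lemma hamilton_deficit_le: "hamilton_deficit V E \<le> Suc (card V)"
  by (simp add: hamilton_deficit_def)

lemma hamilton_deficit_eq_0_iff:
  "finite V \<Longrightarrow> V \<noteq> {} \<Longrightarrow> hamilton_deficit V E = 0 \<longleftrightarrow> hamiltonian V E"
  using longest_path_le_card[of V E] by (auto simp: hamilton_deficit_def)

lemma hamilton_deficit_mono:
  assumes "finite V" "V \<noteq> {}" "\<And>u v. E u v \<Longrightarrow> E' u v"
  shows "hamilton_deficit V E' \<le> hamilton_deficit V E"
  using longest_path_mono[of V E E', OF assms] hamiltonian_mono[of V E E'] assms(3)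
  by (auto simp: hamilton_deficit_def)

text \<open>The path closes to a cycle. If the cycle misses a vertex, connectivity gives an edge
  from some \<open>a\<close> on it to some \<open>b\<close> off it; cutting the cycle open at
  \<open>a\<close> and prepending \<open>b\<close> gains one vertex.\<close>

lemma hamiltonian_or_longer_path:
  assumes sym: "symp E" and xs: "path_in V E xs" and cyc: "E (last xs) (hd xs)" "3 \<le> length xs"
    and conn: "connected_on V E"
  shows "hamiltonian V E \<or> (\<exists>ys. path_in V E ys \<and> length ys = Suc (length xs))"
proof (cases "set xs = V")
  case True
  then show ?thesis using xs cyc by (auto simp: hamiltonian_def)
next
  case False
  with xs conn obtain a b where ab: "a \<in> set xs" "b \<in> V - set xs" "E a b"
    unfolding connected_on_def path_in_def by (metis set_empty)
  then obtain as bs where split: "xs = as @ a # bs" by (auto simp: in_set_conv_decomp)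
  \<comment> \<open>The closing edge joins the end of \<open>a # bs\<close> to the head of
    \<open>as\<close>; for empty \<open>as\<close> the path already starts at
    \<open>a\<close>.\<close>
  have "successively E ((a # bs) @ as)"
    using xs cyc unfolding split
    by (cases "as = []") (auto simp: path_in_def successively_append_iff successively_Cons split: if_splits)
  then have "path_in V E (b # (a # bs) @ as)"
    using xs ab sym unfolding split by (auto simp: path_in_def symp_def)
  then show ?thesis unfolding split by (intro disjI2 exI[of _ "b # (a # bs) @ as"]) auto
qed

lemma hamilton_deficit_less:
  assumes V: "finite V" "V \<noteq> {}" and sub: "\<And>u v. E u v \<Longrightarrow> E' u v"
    and sym: "symp E'" and conn: "connected_on V E'"
    and nham: "\<not> hamiltonian V E"
    and xs: "path_in V E xs" "length xs = longest_path V E" "3 \<le> length xs" "E' (last xs) (hd xs)"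
  shows "hamilton_deficit V E' < hamilton_deficit V E"
proof -
  have pos: "0 < hamilton_deficit V E" using hamilton_deficit_eq_0_iff[OF V] nham by blast
  show ?thesis
  proof (cases "hamiltonian V E'")
    case True
    then show ?thesis using pos by (simp add: hamilton_deficit_def)
  next
    case False
    with hamiltonian_or_longer_path[OF sym path_in_mono[OF xs(1) sub] xs(4,3) conn]
    obtain ys where "path_in V E' ys" "length ys = Suc (length xs)" by blast
    then have "Suc (longest_path V E) \<le> longest_path V E'"
      using length_le_longest_path[OF V(1)] xs(2) by metis
    moreover have "longest_path V E' \<le> card V" by (rule longest_path_le_card[OF V])
    ultimately show ?thesis using False nham by (simp add: hamilton_deficit_def)
  qed
qed

definition longest_path_ends :: "'a set \<Rightarrow> ('a \<Rightarrow> 'a \<Rightarrow> bool) \<Rightarrow> 'a \<Rightarrow> 'a set" where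
  "longest_path_ends V E x =
     {y. \<exists>xs. path_in V E xs \<and> length xs = longest_path V E \<and> hd xs = x \<and> last xs = y}"

lemma longest_path_ends_subset: "longest_path_ends V E x \<subseteq> V"
  by (auto simp: longest_path_ends_def path_in_def)

lemma finite_longest_path_ends: "finite V \<Longrightarrow> finite (longest_path_ends V E x)"
  using longest_path_ends_subset by (rule finite_subset)

text \<open>Rotations are applied twice. Those of one longest path give more than \<open>s\<close>
  ends \<open>x\<close>; each rotated path, read backwards, is a longest path starting in
  \<open>x\<close>, and its own rotations give more than \<open>s\<close> other ends. The bound on
  the length follows because all ends lie on the path.\<close>

lemma posa:
  fixes s :: real
  assumes V: "finite V" "V \<noteq> {}" and sym: "symp E"
    and expand: "\<And>A. A \<subseteq> V \<Longrightarrow> A \<noteq> {} \<Longrightarrow> real (card A) \<le> s \<Longrightarrow>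
                   2 * card A < card ({v \<in> V. \<exists>u\<in>A. E u v} - A)"
  shows "s < card {x \<in> V. s < card (longest_path_ends V E x)}" "s < longest_path V E"
proof -
  have big: "rotation_ends E xs \<subseteq> longest_path_ends V E (hd xs)" "s < card (rotation_ends E xs)"
    if xs: "path_in V E xs" "length xs = longest_path V E" for xs
  proof -
    show "rotation_ends E xs \<subseteq> longest_path_ends V E (hd xs)"
      using rotation_path[OF _ sym xs(1)] xs(2)
      by (auto simp: rotation_ends_def longest_path_ends_def)
    show "s < card (rotation_ends E xs)"
      using length_le_longest_path[OF V(1)] xs(2) by (intro card_rotation_ends[OF V(1) sym xs(1) _ expand]) metis
  qed
  obtain xs where xs: "path_in V E xs" "length xs = longest_path V E" using ex_longest_path[OF V] .
  have "rotation_ends E xs \<subseteq> {x \<in> V. s < card (longest_path_ends V E x)}"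
  proof
    fix x assume "x \<in> rotation_ends E xs"
    then obtain ys where ys: "rotation E xs ys" "x = last ys" by (auto simp: rotation_ends_def)
    note p = rotation_path[OF ys(1) sym xs(1)]
    have r: "path_in V E (rev ys)" "length (rev ys) = longest_path V E" "hd (rev ys) = x"
      using p xs(2) ys(2) by (auto simp: path_in_def successively_rev_symp[OF sym] hd_rev simp del: successively_rev)
    have "s < card (rotation_ends E (rev ys))" by (rule big(2)[OF r(1,2)])
    also have "card (rotation_ends E (rev ys)) \<le> card (longest_path_ends V E x)"
      using big(1)[OF r(1,2)] r(3) by (intro card_mono finite_longest_path_ends[OF V(1)]) simp
    finally have "s < card (longest_path_ends V E x)" by simp
    moreover have "x \<in> V" using p ys(2) by (auto simp: path_in_def)
    ultimately show "x \<in> {x \<in> V. s < card (longest_path_ends V E x)}" by simp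
  qed
  then have "card (rotation_ends E xs) \<le> card {x \<in> V. s < card (longest_path_ends V E x)}"
    using V(1) by (intro card_mono) auto
  then show "s < card {x \<in> V. s < card (longest_path_ends V E x)}" using big(2)[OF xs] by linarith
  have "card (rotation_ends E xs) \<le> card (set xs)"
    by (intro card_mono rotation_ends_subset[OF sym xs(1)]) auto
  also have "\<dots> \<le> longest_path V E" using xs(2) card_length[of xs] by simp
  finally show "s < longest_path V E" using big(2)[OF xs] by linarith
qed

section \<open>Expansion and connectivity of the intersection graph\<close>

definition feature_adj :: "nat \<Rightarrow> nat \<Rightarrow> (nat \<times> nat \<Rightarrow> bool) \<Rightarrow> nat \<Rightarrow> nat \<Rightarrow> bool" where
  "feature_adj n m R u v \<longleftrightarrow> u < n \<and> v < n \<and> u \<noteq> v \<and> (\<exists>w<m. R (u, w) \<and> R (v, w))"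

definition features_of :: "nat \<Rightarrow> (nat \<times> nat \<Rightarrow> bool) \<Rightarrow> nat set \<Rightarrow> nat set" where
  "features_of m R A = {w. w < m \<and> (\<exists>v\<in>A. R (v, w))}"

definition vertices_of :: "nat \<Rightarrow> (nat \<times> nat \<Rightarrow> bool) \<Rightarrow> nat set \<Rightarrow> nat set" where
  "vertices_of n R F = {v. v < n \<and> (\<exists>w\<in>F. R (v, w))}"

text \<open>\<open>vertices_of n R (features_of m R A)\<close> consists of the neighbours of
  \<open>A\<close> and those members of \<open>A\<close> that have a feature, so the factor 3 leaves
  \<open>2 * card A + k\<close> neighbours outside \<open>A\<close>. The second clause forces two
  large sets to share a feature. Both clauses are preserved when incidences are added.\<close>

definition expanding :: "nat \<Rightarrow> nat \<Rightarrow> nat \<Rightarrow> real \<Rightarrow> (nat \<times> nat \<Rightarrow> bool) \<Rightarrow> bool" where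
  "expanding n m k s R \<longleftrightarrow>
     (\<forall>A\<subseteq>{..<n}. A \<noteq> {} \<and> real (card A) \<le> s \<longrightarrow>
        3 * card A + k \<le> card (vertices_of n R (features_of m R A))) \<and>
     (\<forall>B\<subseteq>{..<n}. s < real (card B) \<longrightarrow> m < 2 * card (features_of m R B))"

lemma finite_features_of [simp]: "finite (features_of m R A)"
  by (rule finite_subset[of _ "{..<m}"]) (auto simp: features_of_def)

lemma finite_vertices_of [simp]: "finite (vertices_of n R F)"
  by (rule finite_subset[of _ "{..<n}"]) (auto simp: vertices_of_def)

lemma symp_feature_adj: "symp (feature_adj n m R)"
  by (auto simp: symp_def feature_adj_def)

lemma feature_adj_mono: "feature_adj n m R u v \<Longrightarrow> feature_adj n m (\<lambda>x. R x \<or> S x) u v"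
  by (auto simp: feature_adj_def)

lemma expanding_mono:
  assumes "expanding n m k s R"
  shows "expanding n m k s (\<lambda>x. R x \<or> S x)"
proof -
  have f: "features_of m R A \<subseteq> features_of m (\<lambda>x. R x \<or> S x) A" for A
    by (auto simp: features_of_def)
  have "vertices_of n R (features_of m R A) \<subseteq>
        vertices_of n (\<lambda>x. R x \<or> S x) (features_of m (\<lambda>x. R x \<or> S x) A)" for A
    by (auto simp: vertices_of_def features_of_def)
  then show ?thesis
    using assms card_mono[OF finite_features_of f] card_mono[OF finite_vertices_of]
    unfolding expanding_def by (meson le_trans less_le_trans mult_le_mono2)
qed

text \<open>If no edge runs from \<open>A\<close> to \<open>U\<close>, then the vertices sharing a
  feature with \<open>A\<close> lie in \<open>A \<union> S\<close>, which is too few for the first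
  clause, so \<open>A\<close> is large; likewise \<open>U\<close>. The feature sets touched by
  \<open>A\<close> and \<open>U\<close> are then disjoint and each exceeds half of all
  features.\<close>

lemma expanding_no_small_cut:
  assumes ex: "expanding n m k s R"
    and part: "A \<union> U \<union> S = {..<n}" "A \<inter> U = {}" "A \<noteq> {}" "U \<noteq> {}" and S: "card S < k"
  shows "\<exists>a\<in>A. \<exists>u\<in>U. feature_adj n m R a u"
proof (rule ccontr)
  assume none: "\<not> ?thesis"
  have large: "s < real (card X)"
    if X: "X \<subseteq> {..<n}" "X \<noteq> {}" "vertices_of n R (features_of m R X) \<subseteq> X \<union> S" for X
  proof (rule ccontr)
    assume "\<not> s < real (card X)"
    then have "3 * card X + k \<le> card (vertices_of n R (features_of m R X))"
      using ex X by (auto simp: expanding_def)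
    also have "\<dots> \<le> card (X \<union> S)"
      using X part by (intro card_mono) (auto intro: finite_subset[of _ "{..<n}"])
    also have "\<dots> \<le> card X + card S" by (rule card_Un_le)
    finally show False using S by simp
  qed
  have sub: "A \<subseteq> {..<n}" "U \<subseteq> {..<n}" using part by auto
  have disj: "R (a, w) \<Longrightarrow> R (u, w) \<Longrightarrow> w < m \<Longrightarrow> False" if "a \<in> A" "u \<in> U" for a u w
    using none that part sub unfolding feature_adj_def by (metis IntI empty_iff lessThan_iff subsetD)
  have cover: "vertices_of n R (features_of m R X) \<subseteq> X \<union> S"
    if XY: "X \<union> Y \<union> S = {..<n}"
      and sep: "\<And>x y w. x \<in> X \<Longrightarrow> y \<in> Y \<Longrightarrow> R (x, w) \<Longrightarrow> R (y, w) \<Longrightarrow> w < m \<Longrightarrow> False" for X Y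
  proof
    fix v assume "v \<in> vertices_of n R (features_of m R X)"
    then obtain a w where "v < n" "w < m" "a \<in> X" "R (a, w)" "R (v, w)"
      by (auto simp: vertices_of_def features_of_def)
    then have "v \<notin> Y" using sep by blast
    then show "v \<in> X \<union> S" using XY \<open>v < n\<close> by blast
  qed
  have "s < real (card A)" "s < real (card U)"
    using large[OF sub(1) part(3) cover[OF part(1)]] large[OF sub(2) part(4) cover[of U A]]
      part(1) disj by blast+
  then have "m < 2 * card (features_of m R A)" "m < 2 * card (features_of m R U)"
    using ex sub by (auto simp: expanding_def)
  moreover have "card (features_of m R A \<union> features_of m R U) =
      card (features_of m R A) + card (features_of m R U)"
    using disj by (intro card_Un_disjoint) (auto simp: features_of_def)
  moreover have "card (features_of m R A \<union> features_of m R U) \<le> card {..<m}"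
    by (intro card_mono) (auto simp: features_of_def)
  ultimately show False by simp
qed

lemma expanding_connected_on:
  assumes "expanding n m k s R" "0 < k"
  shows "connected_on {..<n} (feature_adj n m R)"
  unfolding connected_on_def
proof (intro allI impI)
  fix A assume A: "A \<subseteq> {..<n}" "A \<noteq> {} \<and> A \<noteq> {..<n}"
  then show "\<exists>a\<in>A. \<exists>b\<in>{..<n} - A. feature_adj n m R a b"
    using assms by (intro expanding_no_small_cut[where S = "{}" and k = k]) auto
qed

section \<open>Transfer to connectivity and cycles of digraphs\<close>

lemma parcs_intersection_graph:
  "(u, v) \<in> parcs (intersection_graph n m R) \<longleftrightarrow> feature_adj n m R u v"
  by (auto simp: intersection_graph_def feature_adj_def feature_set_def)

lemma pverts_intersection_graph [simp]: "pverts (intersection_graph n m R) = {..<n}"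
  by (simp add: intersection_graph_def)

text \<open>After removal of \<open>S\<close>, the vertices reachable from \<open>u\<close> and the
  unreachable ones would form a cut without edges. Connectedness of a digraph unfolds to strong
  connectivity of its symmetric closure, which is where \<open>?H\<close> comes from.\<close>

lemma k_connected_intersection_graph:
  assumes ex: "expanding n m k s R" and "k < n"
  shows "k_connected k (with_proj (intersection_graph n m R))"
  unfolding k_connected_def
proof (intro conjI allI impI; (elim conjE)?)
  fix S assume S: "S \<subseteq> verts (with_proj (intersection_graph n m R))" "finite S" "card S < k"
  let ?W = "{..<n} - S"
  let ?H = "mk_symmetric (induce_subgraph (with_proj (intersection_graph n m R)) ?W)"
  have W: "?W \<noteq> {}"
  proof
    assume "?W = {}"
    then have "card {..<n} \<le> card S" using S(2) by (intro card_mono) auto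
    then show False using S(3) \<open>k < n\<close> by simp
  qed
  have vH: "verts (with_proj ?H) = ?W" by (simp add: mk_symmetric_def)
  have aH: "(u, v) \<in> arcs_ends (with_proj ?H)" if "u \<in> ?W" "v \<in> ?W" "feature_adj n m R u v" for u v
    using that parcs_intersection_graph[of u v n m R]
    unfolding mk_symmetric_def arcs_ends_def arc_to_ends_def
    by (force simp: image_iff)
  have "(u, v) \<in> rtrancl_on ?W (arcs_ends (with_proj ?H))" if uv: "u \<in> ?W" "v \<in> ?W" for u v
  proof (rule ccontr)
    let ?A = "{x \<in> ?W. (u, x) \<in> rtrancl_on ?W (arcs_ends (with_proj ?H))}"
    assume "(u, v) \<notin> rtrancl_on ?W (arcs_ends (with_proj ?H))"
    then have "\<exists>a\<in>?A. \<exists>b\<in>?W - ?A. feature_adj n m R a b"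
      using uv S by (intro expanding_no_small_cut[OF ex _ _ _ _ S(3)]) (auto intro: rtrancl_on_refl)
    then obtain a b where ab: "a \<in> ?A" "b \<in> ?W - ?A" "feature_adj n m R a b" by blast
    then have "(u, b) \<in> rtrancl_on ?W (arcs_ends (with_proj ?H))"
      using aH by (blast intro: rtrancl_on_into_rtrancl_on)
    then show False using ab by blast
  qed
  then show "Digraph_Component.connected (induce_subgraph (with_proj (intersection_graph n m R))
      (verts (with_proj (intersection_graph n m R)) - S))"
    using W vH unfolding Digraph_Component.connected_def strongly_connected_def reachable_def
    by simp
qed (use \<open>k < n\<close> in simp)

lemma hamiltonian_imp_has_hamilton_cycle:
  assumes "hamiltonian {..<n} (feature_adj n m R)"
  shows "has_hamilton_cycle (with_proj (intersection_graph n m R))"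
proof -
  let ?G = "with_proj (intersection_graph n m R)"
  obtain xs where xs: "path_in {..<n} (feature_adj n m R) xs" "set xs = {..<n}" "3 \<le> length xs"
    "feature_adj n m R (last xs) (hd xs)"
    using assms by (auto simp: hamiltonian_def)
  define c where "c = zip xs (tl xs @ [hd xs])"
  \<comment> \<open>The final vertex \<open>y\<close> is arbitrary because the induction shortens
    the list at the front while the closing vertex \<open>hd xs\<close> stays the same.\<close>
  have walk: "pre_digraph.cas ?G (hd ys) (zip ys (tl ys @ [y])) y \<and>
      pre_digraph.awalk_verts ?G (hd ys) (zip ys (tl ys @ [y])) = ys @ [y] \<and>
      set (zip ys (tl ys @ [y])) \<subseteq> arcs ?G"
    if "ys \<noteq> []" "successively (feature_adj n m R) ys" "feature_adj n m R (last ys) y" for ys y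
    using that
  proof (induction ys rule: induct_list012)
    case (2 x)
    then show ?case
      by (simp add: pre_digraph.cas.simps pre_digraph.awalk_verts.simps parcs_intersection_graph)
  next
    case (3 x x' zs)
    then show ?case
      by (simp add: pre_digraph.cas.simps pre_digraph.awalk_verts.simps parcs_intersection_graph)
  qed simp
  have w: "pre_digraph.cas ?G (hd xs) c (hd xs)" "pre_digraph.awalk_verts ?G (hd xs) c = xs @ [hd xs]"
    "set c \<subseteq> arcs ?G"
    unfolding c_def using walk[of xs "hd xs"] xs by (auto simp: path_in_def)
  have ne: "xs \<noteq> []" using xs(3) by auto
  have "pre_digraph.awalk ?G (hd xs) c (hd xs)"
    unfolding pre_digraph.awalk_def using w xs(2) hd_in_set[OF ne] by simp
  moreover have "distinct (tl (pre_digraph.awalk_verts ?G (hd xs) c))"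
    using xs(1) ne unfolding w(2) by (cases xs) (auto simp: path_in_def)
  moreover have len: "length c = length xs" using ne by (simp add: c_def)
  ultimately have "pre_digraph.cycle ?G c"
    unfolding pre_digraph.cycle_def using ne by auto
  moreover have "fst ` set c = set xs"
    using ne by (metis c_def length_append_singleton length_tl list.set_map map_fst_zip
        Suc_diff_1 length_greater_0_conv)
  ultimately show ?thesis
    unfolding has_hamilton_cycle_def using len xs(2,3) by (intro exI[of _ c]) simp
qed

text \<open>Already the empty \<open>S\<close> is a witness: there is a second vertex
  \<open>u\<close>, and a walk from \<open>v\<close> to \<open>u\<close> would start with an arc at
  \<open>v\<close>.\<close>

lemma isolated_not_k_connected:
  assumes "v < n" "feature_set m R v = {}" "1 \<le> k"
  shows "\<not> k_connected k (with_proj (intersection_graph n m R))"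
proof
  let ?G = "with_proj (intersection_graph n m R)"
  assume kc: "k_connected k ?G"
  then have "1 < n" using \<open>1 \<le> k\<close> by (auto simp: k_connected_def)
  then obtain u where u: "u < n" "u \<noteq> v"
    by (metis less_numeral_extra(1) less_one less_trans nat_neq_iff)
  have "Digraph_Component.connected (induce_subgraph ?G (verts ?G - {}))"
    using kc \<open>1 \<le> k\<close> unfolding k_connected_def by (metis card.empty empty_subsetI finite.emptyI less_le_trans zero_less_one)
  then have "reachable (with_proj (mk_symmetric (induce_subgraph ?G {..<n}))) v u"
    using u assms(1) by (simp add: Digraph_Component.connected_def strongly_connected_def mk_symmetric_def)
  then have "(v, u) \<in> rtrancl_on {..<n} (arcs_ends (with_proj (mk_symmetric (induce_subgraph ?G {..<n}))))"
    by (simp add: reachable_def mk_symmetric_def)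
  then obtain x where "(v, x) \<in> arcs_ends (with_proj (mk_symmetric (induce_subgraph ?G {..<n})))"
    using u(2) by (cases rule: converse_rtrancl_on_cases) auto
  then have "feature_adj n m R v x \<or> feature_adj n m R x v"
    using parcs_intersection_graph[of _ _ n m R]
    by (force simp: mk_symmetric_def arcs_ends_def arc_to_ends_def)
  then show False using assms(2) by (auto simp: feature_adj_def feature_set_def)
qed

text \<open>Every vertex is the tail of an arc of a Hamilton cycle, but \<open>v\<close> has no
  arcs.\<close>

lemma isolated_not_has_hamilton_cycle:
  assumes "v < n" "feature_set m R v = {}"
  shows "\<not> has_hamilton_cycle (with_proj (intersection_graph n m R))"
proof
  let ?G = "with_proj (intersection_graph n m R)"
  assume "has_hamilton_cycle ?G"
  then obtain c where c: "pre_digraph.cycle ?G c" "tail ?G ` set c = {..<n}"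
    by (auto simp: has_hamilton_cycle_def)
  then have "v \<in> fst ` set c" using assms(1) by simp
  then obtain e where e: "e \<in> set c" "fst e = v" by auto
  have "e \<in> parcs (intersection_graph n m R)"
    using c(1) e(1) by (auto simp: pre_digraph.cycle_def pre_digraph.awalk_def)
  then have "feature_adj n m R v (snd e)" using parcs_intersection_graph[of v "snd e" n m R] e(2)
    by (metis prod.collapse)
  then show False using assms(2) by (auto simp: feature_adj_def feature_set_def)
qed

section \<open>Sprinkling\<close>

lemma hamiltonian_feature_adj_mono:
  assumes "hamiltonian V (feature_adj n m R)"
  shows "hamiltonian V (feature_adj n m (\<lambda>x. R x \<or> S x))"
  using hamiltonian_mono[of V "feature_adj n m R" "feature_adj n m (\<lambda>x. R x \<or> S x)"]
    feature_adj_mono[of n m R _ _ S] assms by simp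

lemma hamilton_deficit_feature_adj_mono:
  assumes "finite V" "V \<noteq> {}"
  shows "hamilton_deficit V (feature_adj n m (\<lambda>x. R x \<or> S x)) \<le> hamilton_deficit V (feature_adj n m R)"
  using hamilton_deficit_mono[of V "feature_adj n m R" "feature_adj n m (\<lambda>x. R x \<or> S x)"]
    feature_adj_mono[of n m R _ _ S] assms by simp

lemma expanding_neighbours:
  assumes ex: "expanding n m k s R" and "0 < k"
    and A: "A \<subseteq> {..<n}" "A \<noteq> {}" "real (card A) \<le> s"
  shows "2 * card A < card ({v \<in> {..<n}. \<exists>u\<in>A. feature_adj n m R u v} - A)"
proof -
  let ?N = "{v \<in> {..<n}. \<exists>u\<in>A. feature_adj n m R u v} - A"
  have "3 * card A + k \<le> card (vertices_of n R (features_of m R A))"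
    using ex A by (auto simp: expanding_def)
  also have "\<dots> \<le> card (A \<union> ?N)"
    using A by (intro card_mono)
      (auto simp: vertices_of_def features_of_def feature_adj_def intro: finite_subset[of _ "{..<n}"])
  also have "\<dots> \<le> card A + card ?N" by (rule card_Un_le)
  finally show ?thesis using \<open>0 < k\<close> by linarith
qed

text \<open>\<open>X\<close> pairs a start \<open>v\<close> of longest paths with a feature
  \<open>w\<close> of one of its more than \<open>s\<close> possible other ends: giving
  \<open>w\<close> to \<open>v\<close> closes a longest path. There are more than \<open>s\<close>
  such starts, and the ends belonging to each touch more than half of the features. \<open>X\<close>
  is fixed by \<open>R\<close> alone, before the next round is drawn.\<close>

lemma boosters:
  assumes ex: "expanding n m k s R" and "0 < k" "2 \<le> s" "0 < n"
    and nham: "\<not> hamiltonian {..<n} (feature_adj n m R)"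
  shows "\<exists>X. X \<subseteq> {..<n} \<times> {..<m} \<and> s * m / 2 \<le> card X \<and>
    (\<forall>S. (\<exists>x\<in>X. S x) \<longrightarrow> hamilton_deficit {..<n} (feature_adj n m (\<lambda>x. R x \<or> S x)) <
                           hamilton_deficit {..<n} (feature_adj n m R))"
proof -
  let ?E = "feature_adj n m R"
  have V: "finite {..<n}" "{..<n} \<noteq> {}" using \<open>0 < n\<close> by auto
  define D where "D = {x \<in> {..<n}. s < card (longest_path_ends {..<n} ?E x)}"
  define X where "X = Sigma D (\<lambda>v. features_of m R (longest_path_ends {..<n} ?E v))"
  have D: "s < card D" and len: "s < longest_path {..<n} ?E"
    unfolding D_def by (rule posa[OF V symp_feature_adj expanding_neighbours[OF ex \<open>0 < k\<close>]]; assumption)+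
  have fD: "finite D" by (simp add: D_def)
  show ?thesis
  proof (intro exI[of _ X] conjI allI impI)
    show "X \<subseteq> {..<n} \<times> {..<m}" by (auto simp: X_def D_def features_of_def)
    have half: "real m / 2 \<le> card (features_of m R (longest_path_ends {..<n} ?E v))" if "v \<in> D" for v
    proof -
      have "m < 2 * card (features_of m R (longest_path_ends {..<n} ?E v))"
        using ex that longest_path_ends_subset[of "{..<n}" ?E v] by (auto simp: expanding_def D_def)
      then show ?thesis by linarith
    qed
    have "s * m / 2 \<le> real (card D) * (m / 2)" using D by (simp add: mult_right_mono)
    also have "\<dots> = (\<Sum>v\<in>D. real m / 2)" by simp
    also have "\<dots> \<le> (\<Sum>v\<in>D. real (card (features_of m R (longest_path_ends {..<n} ?E v))))"
      by (intro sum_mono half)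
    also have "\<dots> = card X" unfolding X_def using fD by (simp add: card_SigmaI)
    finally show "s * m / 2 \<le> card X" .
    fix S :: "nat \<times> nat \<Rightarrow> bool" assume "\<exists>x\<in>X. S x"
    then obtain v w where vw: "v \<in> D" "w \<in> features_of m R (longest_path_ends {..<n} ?E v)" "S (v, w)"
      by (auto simp: X_def)
    then obtain u where u: "u \<in> longest_path_ends {..<n} ?E v" "R (u, w)" "w < m"
      by (auto simp: features_of_def)
    then obtain xs where xs: "path_in {..<n} ?E xs" "length xs = longest_path {..<n} ?E"
      "hd xs = v" "last xs = u"
      by (auto simp: longest_path_ends_def)
    have l3: "3 \<le> length xs" using len \<open>2 \<le> s\<close> xs(2) by linarith
    \<comment> \<open>A path of at least three distinct vertices has different ends; this is the use
      of \<open>2 \<le> s\<close>.\<close>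
    have "u \<noteq> v"
      using xs l3 by (cases xs) (auto simp: path_in_def split: if_splits)
    moreover have "u \<in> set xs" "v \<in> set xs" using xs by (auto simp: path_in_def)
    then have "u < n" "v < n" using xs(1) by (auto simp: path_in_def)
    ultimately have "feature_adj n m (\<lambda>x. R x \<or> S x) (last xs) (hd xs)"
      using xs vw u by (auto simp: feature_adj_def)
    then show "hamilton_deficit {..<n} (feature_adj n m (\<lambda>x. R x \<or> S x)) <
               hamilton_deficit {..<n} ?E"
      by (intro hamilton_deficit_less[OF V feature_adj_mono symp_feature_adj _ nham xs(1,2) l3]
            expanding_connected_on[OF expanding_mono[OF ex] \<open>0 < k\<close>])
  qed
qed

text \<open>Failure requires missing every element of \<open>X\<close>, which has probability at
  most \<open>exp (- (q * card X))\<close>. Here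
  \<open>q * card X \<ge> q * s * m / 2 \<ge> 2\<close>, and
  \<open>exp (- 2) \<le> 1 / 4\<close>.\<close>

lemma prob_no_booster:
  assumes ex: "expanding n m k s R" and "0 < k" "2 \<le> s" "0 < n"
    and nham: "\<not> hamiltonian {..<n} (feature_adj n m R)"
    and q: "0 \<le> q" "q \<le> 1" "4 \<le> q * s * m"
  shows "measure_pmf.prob (bernoulli_family ({..<n} \<times> {..<m}) q)
           {S. \<not> hamilton_deficit {..<n} (feature_adj n m (\<lambda>x. R x \<or> S x)) <
                hamilton_deficit {..<n} (feature_adj n m R)} \<le> 1 / 4"
proof -
  obtain X where X: "X \<subseteq> {..<n} \<times> {..<m}" "s * m / 2 \<le> card X"
    "\<And>S. \<exists>x\<in>X. S x \<Longrightarrow> hamilton_deficit {..<n} (feature_adj n m (\<lambda>x. R x \<or> S x)) <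
                       hamilton_deficit {..<n} (feature_adj n m R)"
    using boosters[OF assms(1-5)] by (elim exE conjE) (rule that, assumption, assumption, simp)
  have "measure_pmf.prob (bernoulli_family ({..<n} \<times> {..<m}) q)
           {S. \<not> hamilton_deficit {..<n} (feature_adj n m (\<lambda>x. R x \<or> S x)) <
                hamilton_deficit {..<n} (feature_adj n m R)}
        \<le> measure_pmf.prob (bernoulli_family ({..<n} \<times> {..<m}) q) {S. \<forall>x\<in>X. \<not> S x}"
  proof (rule measure_pmf.finite_measure_mono)
    show "{S. \<not> hamilton_deficit {..<n} (feature_adj n m (\<lambda>x. R x \<or> S x)) <
               hamilton_deficit {..<n} (feature_adj n m R)} \<subseteq> {S. \<forall>x\<in>X. \<not> S x}"
      using X(3) by blast
  qed simp
  also have "\<dots> = (1 - q) ^ card X" using X(1) q by (intro prob_bernoulli_family_all_False) auto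
  also have "\<dots> \<le> exp (- q) ^ card X" using q exp_ge_add_one_self[of "- q"] by (intro power_mono) auto
  also have "\<dots> = exp (- (q * card X))" by (simp flip: exp_of_nat2_mult)
  also have "\<dots> \<le> exp (- 2)"
  proof -
    have "2 \<le> q * (s * m / 2)" using q(3) by (simp add: algebra_simps)
    also have "\<dots> \<le> q * card X" using X(2) q(1) by (rule mult_left_mono)
    finally show ?thesis by simp
  qed
  also have "\<dots> \<le> 1 / 4"
  proof -
    have "(2::real) ^ 2 \<le> exp 1 ^ 2" by (intro power_mono) (use exp_ge_add_one_self[of 1] in auto)
    then have "(4::real) \<le> exp 2" by (simp flip: exp_of_nat2_mult)
    then show ?thesis by (simp add: exp_minus field_simps)
  qed
  finally show ?thesis .
qed


lemma expectation_affine_indicator: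
  "measure_pmf.expectation M (\<lambda>x. c * indicator Y x + d) = c * measure_pmf.prob M Y + (d::real)"
proof -
  have "integrable (measure_pmf M) (\<lambda>x. c * indicator Y x)"
    by (intro measure_pmf.integrable_const_bound[where B = "\<bar>c\<bar>"]) (auto simp: indicator_def)
  then show ?thesis by simp
qed

text \<open>
  The bound \<open>4 ^ d / 2 ^ t\<close> is an invariant: a round lowers the deficit \<open>d\<close> with probability at
  least \<open>3/4\<close>, and \<open>1/4 \<cdot> 4 ^ d + 4 ^ (d - 1) = 4 ^ d / 2\<close>.
\<close>
lemma sprinkling:
  assumes "expanding n m k s R" and k: "0 < k" and s: "2 \<le> s" and n: "0 < n"
    and q: "0 \<le> q" "q \<le> 1" "4 \<le> q * s * m"
  shows "measure_pmf.prob (bernoulli_family ({..<n} \<times> {..<m}) (1 - (1 - q) ^ t))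
           {S. \<not> hamiltonian {..<n} (feature_adj n m (\<lambda>x. R x \<or> S x))}
         \<le> 4 ^ hamilton_deficit {..<n} (feature_adj n m R) / 2 ^ t"
  using assms(1)
proof (induction t arbitrary: R)
  case 0
  have "(1::real) \<le> 4 ^ hamilton_deficit {..<n} (feature_adj n m R) / 2 ^ 0" by simp
  then show ?case by (rule order_trans[OF measure_pmf.prob_le_1])
next
  case (Suc t)
  let ?E = "\<lambda>R. feature_adj n m R"
  let ?d = "\<lambda>R. hamilton_deficit {..<n} (?E R)"
  let ?B = "\<lambda>p. bernoulli_family ({..<n} \<times> {..<m}) p"
  let ?r = "1 - (1 - q) ^ t"
  let ?Y = "{S. \<not> ?d (\<lambda>x. R x \<or> S x) < ?d R}"
  have V: "finite {..<n}" "{..<n} \<noteq> {}" using n by auto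
  show ?case
  proof (cases "hamiltonian {..<n} (?E R)")
    case True
    then have "hamiltonian {..<n} (?E (\<lambda>x. R x \<or> S x))" for S
      by (rule hamiltonian_feature_adj_mono)
    then show ?thesis by simp
  next
    case False
    then have pos: "0 < ?d R" using hamilton_deficit_eq_0_iff[OF V] by blast
    have r: "0 \<le> ?r" "?r \<le> 1" using q by (simp_all add: power_le_one)
    \<comment> \<open>Given the first round \<open>S\<close>, the induction hypothesis for the
      joined incidences covers the other \<open>t\<close> rounds. In the bad event \<open>?Y\<close>
      the deficit at least does not grow; otherwise it drops by one or more.\<close>
    have step: "measure_pmf.prob (?B ?r) {S'. \<not> hamiltonian {..<n} (?E (\<lambda>x. R x \<or> S x \<or> S' x))}
          \<le> 4 ^ ?d R / 2 ^ t * indicator ?Y S + 4 ^ (?d R - 1) / 2 ^ t" (is "?p S \<le> ?g S") for S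
    proof -
      have "?p S \<le> 4 ^ ?d (\<lambda>x. R x \<or> S x) / 2 ^ t"
        using Suc.IH[OF expanding_mono[OF Suc.prems, of S]] by (simp add: disj_assoc)
      also have "\<dots> \<le> ?g S"
      proof (cases "S \<in> ?Y")
        case True
        have "?d (\<lambda>x. R x \<or> S x) \<le> ?d R"
          by (rule hamilton_deficit_feature_adj_mono[OF V])
        then have "(4::real) ^ ?d (\<lambda>x. R x \<or> S x) \<le> 4 ^ ?d R" by (intro power_increasing) auto
        then have "(4::real) ^ ?d (\<lambda>x. R x \<or> S x) \<le> 4 ^ ?d R + 4 ^ (?d R - 1)"
          by (rule order_trans) simp
        then show ?thesis using True by (simp add: field_simps)
      next
        case False
        then have "?d (\<lambda>x. R x \<or> S x) \<le> ?d R - 1" by auto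
        then have "(4::real) ^ ?d (\<lambda>x. R x \<or> S x) \<le> 4 ^ (?d R - 1)" by (intro power_increasing) auto
        then show ?thesis using False by (simp add: divide_right_mono)
      qed
      finally show ?thesis .
    qed
    have eq: "1 - (1 - q) ^ Suc t = q + ?r - q * ?r" by (simp add: algebra_simps)
    have "measure_pmf.prob (?B (1 - (1 - q) ^ Suc t)) {S. \<not> hamiltonian {..<n} (?E (\<lambda>x. R x \<or> S x))}
          = measure_pmf.expectation (?B q) ?p"
      unfolding eq
      by (rule prob_bernoulli_family_or[OF _ q(1,2) r,
            where P = "\<lambda>S. \<not> hamiltonian {..<n} (?E (\<lambda>x. R x \<or> S x))"]) simp
    also have "\<dots> \<le> measure_pmf.expectation (?B q) ?g"
      by (rule expectation_pmf_le[OF _ step, where B = "4 ^ ?d R / 2 ^ t + 4 ^ (?d R - 1) / 2 ^ t"])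
        (auto simp: indicator_def)
    also have "\<dots> = 4 ^ ?d R / 2 ^ t * measure_pmf.prob (?B q) ?Y + 4 ^ (?d R - 1) / 2 ^ t"
      by (rule expectation_affine_indicator)
    also have "\<dots> \<le> 4 ^ ?d R / 2 ^ t * (1 / 4) + 4 ^ (?d R - 1) / 2 ^ t"
      using prob_no_booster[OF Suc.prems k s n False q] by (intro add_right_mono mult_left_mono) auto
    also have "\<dots> = 4 ^ ?d R / 2 ^ Suc t"
      using pos by (cases "?d R") (simp_all add: field_simps)
    finally show ?thesis .
  qed
qed

text \<open>Two phases: incidences with probability \<open>p0\<close> provide expansion, which
  persists when more are added, and \<open>3 * (n + 1)\<close> rounds with probability
  \<open>q\<close> then close longest paths. Together they stay below \<open>p\<close>, and
  Hamiltonicity is increasing.\<close>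

lemma prob_not_hamiltonian_le:
  assumes k: "0 < k" and s: "2 \<le> s" and n: "0 < n" and q: "0 \<le> q" "q \<le> 1" "4 \<le> q * s * m"
    and p: "0 \<le> p0" "p0 + 3 * (real n + 1) * q \<le> p" "p \<le> 1"
  shows "measure_pmf.prob (bernoulli_family ({..<n} \<times> {..<m}) p)
           {R. \<not> hamiltonian {..<n} (feature_adj n m R)}
         \<le> measure_pmf.prob (bernoulli_family ({..<n} \<times> {..<m}) p0) {R. \<not> expanding n m k s R} + 1 / 2 ^ n"
proof -
  let ?B = "\<lambda>p. bernoulli_family ({..<n} \<times> {..<m}) p"
  let ?H = "\<lambda>R. hamiltonian {..<n} (feature_adj n m R)"
  \<comment> \<open>The deficit is at most \<open>n + 1\<close>, so the failure bound is at most
    \<open>4 ^ (n + 1) / 8 ^ (n + 1) = 1 / 2 ^ (n + 1)\<close>.\<close>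
  define t where "t = 3 * (n + 1)"
  define r where "r = 1 - (1 - q) ^ t"
  have r: "0 \<le> r" "r \<le> 1" using q by (simp_all add: r_def power_le_one)
  have "r \<le> t * q" using Bernoulli_inequality[of "- q" t] q by (simp add: r_def)
  also have "t * q = 3 * (real n + 1) * q" by (simp add: t_def algebra_simps)
  finally have rq: "p0 + r \<le> p" using p by simp
  have p0: "0 \<le> p0" "p0 \<le> 1" using p rq r by auto
  let ?p1 = "p0 + r - p0 * r"
  have p1: "0 \<le> ?p1" "?p1 \<le> p"
  proof -
    have "p0 * r \<le> p0" using p0 r by (simp add: mult_left_le)
    then show "0 \<le> ?p1" using r by linarith
    have "0 \<le> p0 * r" using p0 r by simp
    then show "?p1 \<le> p" using rq by linarith
  qed
  have "measure_pmf.prob (?B ?p1) {R. ?H R} \<le> measure_pmf.prob (?B p) {R. ?H R}"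
    using p1 p by (intro prob_bernoulli_family_mono) (auto intro: hamiltonian_feature_adj_mono)
  then have "measure_pmf.prob (?B p) {R. \<not> ?H R} \<le> measure_pmf.prob (?B ?p1) {R. \<not> ?H R}"
    by (simp add: prob_pmf_neg)
  also have "\<dots> = measure_pmf.expectation (?B p0)
      (\<lambda>R. measure_pmf.prob (?B r) {S. \<not> ?H (\<lambda>x. R x \<or> S x)})"
    using p0 r by (intro prob_bernoulli_family_or) auto
  also have "\<dots> \<le> measure_pmf.expectation (?B p0) (\<lambda>R. indicator {R. \<not> expanding n m k s R} R + 1 / 2 ^ n)"
  proof (rule expectation_pmf_le[where B = 2])
    fix R
    show "measure_pmf.prob (?B r) {S. \<not> ?H (\<lambda>x. R x \<or> S x)}
        \<le> indicator {R. \<not> expanding n m k s R} R + 1 / 2 ^ n"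
    proof (cases "expanding n m k s R")
      case True
      have "measure_pmf.prob (?B r) {S. \<not> ?H (\<lambda>x. R x \<or> S x)}
          \<le> 4 ^ hamilton_deficit {..<n} (feature_adj n m R) / 2 ^ t"
        unfolding r_def by (rule sprinkling[OF True k s n q])
      also have "\<dots> \<le> 4 ^ Suc n / 2 ^ t"
        using hamilton_deficit_le[of "{..<n}"] by (intro divide_right_mono power_increasing) auto
      also have "\<dots> = 1 / 2 ^ Suc n"
      proof -
        have "(2::real) ^ t = 4 ^ Suc n * 2 ^ Suc n"
          unfolding t_def by (simp add: power_add power_mult flip: power_mult_distrib)
        then show ?thesis by simp
      qed
      also have "\<dots> \<le> 1 / 2 ^ n" by (simp add: field_simps)
      finally show ?thesis using True by simp
    next
      case False
      then show ?thesis using measure_pmf.prob_le_1[of "?B r"] by (simp add: add_increasing2)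
    qed
  next
    have "(1::real) \<le> 2 ^ Suc n" by (rule one_le_power) simp
    then show "indicator {R. \<not> expanding n m k s R} R + 1 / 2 ^ n \<le> (2::real)" for R
      by (auto simp: indicator_def field_simps)
  qed simp
  also have "\<dots> = measure_pmf.prob (?B p0) {R. \<not> expanding n m k s R} + 1 / 2 ^ n"
    using expectation_affine_indicator[of "?B p0" 1 "{R. \<not> expanding n m k s R}"] by simp
  finally show ?thesis .
qed

section \<open>Tail estimates for features\<close>

lemma prob_pmf_mono:
  assumes "\<And>x. P x \<Longrightarrow> Q x"
  shows "measure_pmf.prob M {x. P x} \<le> measure_pmf.prob M {x. Q x}"
  by (intro measure_pmf.finite_measure_mono) (use assms in auto)

lemma prob_pmf_disj_le:
  "measure_pmf.prob M {x. P x \<or> Q x} \<le> measure_pmf.prob M {x. P x} + measure_pmf.prob M {x. Q x}"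
proof -
  have "{x. P x \<or> Q x} = {x. P x} \<union> {x. Q x}" by auto
  then show ?thesis using measure_Un_le[of "{x. P x}" "measure_pmf M" "{x. Q x}"] by simp
qed

lemma prob_pmf_bex_le:
  assumes "finite I"
  shows "measure_pmf.prob M {x. \<exists>i\<in>I. P i x} \<le> (\<Sum>i\<in>I. measure_pmf.prob M {x. P i x})"
proof -
  have "{x. \<exists>i\<in>I. P i x} = (\<Union>i\<in>I. {x. P i x})" by auto
  then show ?thesis
    using measure_UNION_le[OF assms, of "\<lambda>i. {x. P i x}" "measure_pmf M"] by simp
qed

lemma prob_pmf_bex_le_card:
  assumes "finite I" "\<And>i. i \<in> I \<Longrightarrow> measure_pmf.prob M {x. P i x} \<le> c"
  shows "measure_pmf.prob M {x. \<exists>i\<in>I. P i x} \<le> real (card I) * c"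
  using prob_pmf_bex_le[OF assms(1), of M P] sum_mono[of I "\<lambda>i. measure_pmf.prob M {x. P i x}" "\<lambda>_. c"]
    assms(2) by simp

lemma prob_pmf_markov:
  assumes "\<And>x. 0 \<le> g x" "\<And>x. g x \<le> B" "\<And>x. P x \<Longrightarrow> 1 \<le> g x"
  shows "measure_pmf.prob M {x. P x} \<le> measure_pmf.expectation M g"
proof -
  have "measure_pmf.prob M {x. P x} = measure_pmf.expectation M (indicator {x. P x})" by simp
  also have "\<dots> \<le> measure_pmf.expectation M g"
    by (rule expectation_pmf_le[where B = B]) (use assms in \<open>auto simp: indicator_def\<close>)
  finally show ?thesis .
qed

text \<open>Chernoff bound from the generating function at \<open>1 / 2\<close>: the expectation is
  \<open>(1 - p / 2) ^ card X\<close>, and \<open>2 powr T\<close> is relaxed to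
  \<open>exp T\<close>.\<close>

lemma prob_bernoulli_family_card_less:
  assumes A: "finite A" "X \<subseteq> A" and p: "0 \<le> p" "p \<le> 1" and T: "0 \<le> T"
  shows "measure_pmf.prob (bernoulli_family A p) {R. real (card {x\<in>X. R x}) < T}
         \<le> exp (T - p * card X / 2)"
proof -
  have fX: "finite X" using A finite_subset by blast
  have e2: "2 powr T \<le> exp T"
    using T ln_2_less_1 by (simp add: powr_def mult_left_le)
  have "measure_pmf.prob (bernoulli_family A p) {R. real (card {x\<in>X. R x}) < T}
      \<le> measure_pmf.expectation (bernoulli_family A p) (\<lambda>R. 2 powr T * (1 / 2) ^ card {x\<in>X. R x})"
  proof (rule prob_pmf_markov[where B = "2 powr T"])
    fix R :: "'a \<Rightarrow> bool"
    show "2 powr T * (1 / 2) ^ card {x\<in>X. R x} \<le> 2 powr T"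
      by (rule mult_left_le) (auto intro: power_le_one)
    assume "real (card {x\<in>X. R x}) < T"
    then have "2 powr real (card {x\<in>X. R x}) \<le> 2 powr T" by (intro powr_mono) auto
    then show "1 \<le> 2 powr T * (1 / 2) ^ card {x\<in>X. R x}"
      by (simp add: powr_realpow power_one_over field_simps)
  qed simp
  also have "\<dots> = 2 powr T * (1 - p + p * (1 / 2)) ^ card X"
    using A p by (simp add: expectation_bernoulli_family_power_card)
  also have "\<dots> = 2 powr T * (1 - p / 2) ^ card X" by (simp add: algebra_simps)
  also have "\<dots> \<le> exp T * exp (- (p / 2)) ^ card X"
    using e2 p exp_ge_add_one_self[of "- (p / 2)"] by (intro mult_mono power_mono) auto
  also have "\<dots> = exp (T - p * card X / 2)"
    unfolding exp_of_nat_mult[symmetric] exp_add[symmetric] by (simp add: algebra_simps)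
  finally show ?thesis .
qed

text \<open>Chernoff bound with free base \<open>l\<close>, since a very large base is used when the
  expected number is far below \<open>T\<close>.\<close>

lemma prob_bernoulli_family_card_ge:
  assumes A: "finite A" "X \<subseteq> A" and p: "0 \<le> p" "p \<le> 1" and l: "1 \<le> l"
  shows "measure_pmf.prob (bernoulli_family A p) {R. T \<le> real (card {x\<in>X. R x})}
         \<le> l powr (- T) * exp (p * l * card X)"
proof -
  have fX: "finite X" using A finite_subset by blast
  have "measure_pmf.prob (bernoulli_family A p) {R. T \<le> real (card {x\<in>X. R x})}
      \<le> measure_pmf.expectation (bernoulli_family A p) (\<lambda>R. l powr (- T) * l ^ card {x\<in>X. R x})"
  proof (rule prob_pmf_markov[where B = "l powr (- T) * l ^ card X"])
    fix R :: "'a \<Rightarrow> bool"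
    show "l powr (- T) * l ^ card {x\<in>X. R x} \<le> l powr (- T) * l ^ card X"
      using l fX by (intro mult_left_mono power_increasing card_mono) auto
    assume "T \<le> real (card {x\<in>X. R x})"
    then have "l powr T \<le> l powr real (card {x\<in>X. R x})" using l by (intro powr_mono) auto
    then show "1 \<le> l powr (- T) * l ^ card {x\<in>X. R x}"
      using l by (simp add: powr_realpow powr_minus field_simps)
  qed (use l in simp)
  also have "\<dots> = l powr (- T) * (1 - p + p * l) ^ card X"
    using A p l by (simp add: expectation_bernoulli_family_power_card)
  also have "\<dots> \<le> l powr (- T) * exp (p * l) ^ card X"
  proof (intro mult_left_mono power_mono)
    have "1 - p + p * l \<le> 1 + p * l" using p by simp
    also have "\<dots> \<le> exp (p * l)" by (rule exp_ge_add_one_self)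
    finally show "1 - p + p * l \<le> exp (p * l)" .
    show "0 \<le> 1 - p + p * l" using p l by (simp add: add_nonneg_nonneg)
  qed simp
  also have "\<dots> = l powr (- T) * exp (p * l * card X)"
    by (simp add: mult.commute flip: exp_of_nat_mult)
  finally show ?thesis .
qed

lemma sum_Pow_power_card: "finite A \<Longrightarrow> (\<Sum>X\<in>Pow A. z ^ card X) = (1 + z :: real) ^ card A"
  using prod_add[of A "\<lambda>_. z" "\<lambda>_. 1"] by (simp add: add.commute)

text \<open>Every counted set has weight \<open>z powr (card X - u) \<ge> 1\<close>, and these
  weights summed over all subsets give \<open>z powr (- u) * (1 + z) ^ card A\<close>.\<close>

lemma card_small_subsets_le:
  assumes A: "finite A" and z: "0 < z" "z \<le> 1"
  shows "real (card {X. X \<subseteq> A \<and> real (card X) \<le> u}) \<le> z powr (- u) * exp (z * card A)"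
proof -
  let ?I = "{X. X \<subseteq> A \<and> real (card X) \<le> u}"
  have "real (card ?I) = (\<Sum>X\<in>?I. 1)" by simp
  also have "\<dots> \<le> (\<Sum>X\<in>?I. z powr (- u) * z ^ card X)"
  proof (rule sum_mono)
    fix X assume "X \<in> ?I"
    then have "z powr u \<le> z powr real (card X)" using z by (intro powr_mono') auto
    then show "1 \<le> z powr (- u) * z ^ card X" using z by (simp add: powr_realpow powr_minus field_simps)
  qed
  also have "\<dots> \<le> (\<Sum>X\<in>Pow A. z powr (- u) * z ^ card X)"
    using A z by (intro sum_mono2) auto
  also have "\<dots> = z powr (- u) * (1 + z) ^ card A"
    using sum_Pow_power_card[OF A, of z] by (simp flip: sum_distrib_left)
  also have "\<dots> \<le> z powr (- u) * exp z ^ card A"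
    using z by (intro mult_left_mono power_mono) auto
  also have "\<dots> = z powr (- u) * exp (z * card A)" by (simp add: mult.commute flip: exp_of_nat_mult)
  finally show ?thesis .
qed

lemma sum_power_le_twice:
  assumes "0 \<le> r" "r \<le> 1 / 2"
  shows "(\<Sum>a=1..K. r ^ a) \<le> 2 * (r::real)"
proof -
  \<comment> \<open>The subtracted term makes the induction close: half of it pays for the next
    summand.\<close>
  have "(\<Sum>a=1..K. r ^ a) \<le> 2 * r - 2 * r ^ Suc K"
  proof (induction K)
    case (Suc K)
    have "r * r ^ Suc K \<le> 1 / 2 * r ^ Suc K" using assms by (intro mult_right_mono) auto
    then show ?case using Suc by simp
  qed simp
  also have "\<dots> \<le> 2 * r" using assms by simp
  finally show ?thesis .
qed

section \<open>Union bounds over vertex sets and feature sets\<close>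

abbreviation incidence_pmf :: "nat \<Rightarrow> nat \<Rightarrow> real \<Rightarrow> (nat \<times> nat \<Rightarrow> bool) pmf" where
  "incidence_pmf n m p \<equiv> bernoulli_family ({..<n} \<times> {..<m}) p"

text \<open>Different features use disjoint sets of incidences, so events that each concern one
  feature are independent.\<close>

lemma prob_incidence_features:
  assumes "F \<subseteq> {..<m}"
    and "\<And>w R R'. w \<in> F \<Longrightarrow> (\<And>v. R (v, w) = R' (v, w)) \<Longrightarrow> P w R = P w R'"
    and "\<And>w. w \<in> F \<Longrightarrow> measure_pmf.prob (incidence_pmf n m p) {R. P w R} \<le> c"
  shows "measure_pmf.prob (incidence_pmf n m p) {R. \<forall>w\<in>F. P w R} \<le> c ^ card F"
proof -
  have "measure_pmf.prob (incidence_pmf n m p) {R. \<forall>w\<in>F. P w R} =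
        (\<Prod>w\<in>F. measure_pmf.prob (incidence_pmf n m p) {R. P w R})"
  proof (rule prob_Pi_pmf_ball[where S = "\<lambda>w. UNIV \<times> {w}"])
    show "finite F" using assms(1) finite_subset by blast
    show "P w R = P w R'" if "w \<in> F" "\<And>x. x \<in> UNIV \<times> {w} \<Longrightarrow> R x = R' x" for w R R'
      by (rule assms(2)[OF that(1)]) (simp add: that(2))
  qed (auto simp: disjoint_family_on_def)
  also have "\<dots> \<le> (\<Prod>w\<in>F. c)" by (intro prod_mono) (use assms(3) in auto)
  finally show ?thesis by simp
qed

lemma card_incidences: "card {x \<in> U \<times> {w}. R x} = card {v \<in> U. R (v, w)}"
proof -
  have "{x \<in> U \<times> {w}. R x} = (\<lambda>v. (v, w)) ` {v \<in> U. R (v, w)}" by auto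
  then show ?thesis by (simp add: card_image inj_on_def)
qed

text \<open>
  The exponent \<open>a * ln n\<close> coming from the choice of \<open>A\<close> leaves no room for a constant factor in
  front of \<open>a * m * p\<close>, so the probability that a feature misses \<open>A\<close> must be kept exact.
\<close>
lemma prob_untouched_or_small:
  fixes p :: real
  assumes p: "0 \<le> p" "p \<le> 1/2" and A: "A \<subseteq> {..<n}" "32 * card A \<le> n" and w: "w < m"
  shows "measure_pmf.prob (incidence_pmf n m p)
      {R. (\<forall>v\<in>A. \<not> R (v, w)) \<or> real (card {v \<in> {..<n} - A. R (v, w)}) < n * p / 8}
      \<le> exp (- (p * card A) + p * card A * exp (- (n * p / 16)))"
proof -
  let ?B = "incidence_pmf n m p" and ?a = "card A" and ?U = "{..<n} - A"
  define x where "x = (1 - p) ^ ?a"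
  define b where "b = exp (- (n * p / 8))"
  let ?T = "\<lambda>R. \<forall>v\<in>A. \<not> R (v, w)" and ?S = "\<lambda>R. real (card {v \<in> ?U. R (v, w)}) < n * p / 8"
  have x01: "0 \<le> x" "x \<le> 1" using p by (auto simp: x_def power_le_one)
  have T: "measure_pmf.prob ?B {R. ?T R} = x"
    using prob_bernoulli_family_all_False[of "{..<n} \<times> {..<m}" "A \<times> {w}" p] A w p
    by (auto simp: x_def card_cartesian_product)
  have S: "measure_pmf.prob ?B {R. ?S R} \<le> b"
  proof -
    have "measure_pmf.prob ?B {R. ?S R} \<le> exp (n * p / 8 - p * card (?U \<times> {w}) / 2)"
      using prob_bernoulli_family_card_less[of "{..<n} \<times> {..<m}" "?U \<times> {w}" p "n * p / 8"] w p
      by (auto simp: card_incidences)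
    also have "\<dots> \<le> b"
    proof -
      have fA: "finite A" using A finite_subset by blast
      have "real (card ?U) = real n - ?a"
        using A fA card_mono[OF _ A(1)] by (simp add: card_Diff_subset of_nat_diff)
      then have "real n / 2 \<le> card ?U" using A(2) by linarith
      then have "p * (real n / 2) \<le> p * card ?U" using p by (intro mult_left_mono) auto
      then show ?thesis by (simp add: b_def card_cartesian_product mult.commute)
    qed
    finally show ?thesis .
  qed
  \<comment> \<open>The two events read incidences of \<open>A\<close> and of its complement, hence
    are independent; this is why only members outside \<open>A\<close> are counted.\<close>
  have "measure_pmf.prob ?B {R. \<not> ?T R \<and> \<not> ?S R} =
        measure_pmf.prob ?B {R. \<not> ?T R} * measure_pmf.prob ?B {R. \<not> ?S R}"
    by (rule prob_Pi_pmf_conj[where S = "A \<times> {w}" and T = "?U \<times> {w}"]) (auto cong: conj_cong)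
  also have "\<dots> \<ge> (1 - x) * (1 - b)"
    unfolding prob_pmf_neg T using S x01 by (intro mult_left_mono) auto
  finally have "measure_pmf.prob ?B {R. ?T R \<or> ?S R} \<le> 1 - (1 - x) * (1 - b)"
    using prob_pmf_neg[of ?B "\<lambda>R. ?T R \<or> ?S R"] by simp
  also have "\<dots> = x + (1 - x) * b" by (simp add: algebra_simps)
  also have "\<dots> \<le> x + (p * ?a) * (exp (- (n * p / 16)) * x)"
  proof (intro add_left_mono mult_mono)
    show "1 - x \<le> p * ?a" using Bernoulli_inequality[of "- p" ?a] p by (simp add: x_def mult.commute)
    \<comment> \<open>Half of the exponent of \<open>b\<close> suffices to produce the factor
      \<open>x\<close>, because \<open>32 * card A \<le> n\<close> makes it at least
      \<open>2 * p * card A\<close>. The other half remains as the correction term.\<close>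
    have "exp (- (n * p / 16)) \<le> exp (- (2 * p * ?a))"
    proof -
      have "p * (32 * real ?a) \<le> p * n" using A(2) p by (intro mult_left_mono) linarith+
      then show ?thesis by (simp add: mult.commute)
    qed
    also have "\<dots> = exp (- (2 * p)) ^ ?a" by (simp add: mult.commute flip: exp_of_nat_mult)
    also have "\<dots> \<le> (1 - p) ^ ?a"
    proof (rule power_mono)
      have "1 \<le> (1 - p) * (1 + 2 * p)" using p by (simp add: algebra_simps mult_left_le)
      also have "\<dots> \<le> (1 - p) * exp (2 * p)" using p by (intro mult_left_mono) auto
      finally show "exp (- (2 * p)) \<le> 1 - p" by (simp add: exp_minus field_simps)
    qed simp
    finally have "exp (- (n * p / 16)) * exp (- (n * p / 16)) \<le> exp (- (n * p / 16)) * x"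
      by (simp add: x_def)
    then show "b \<le> exp (- (n * p / 16)) * x" by (simp add: b_def ac_simps flip: exp_add)
  qed (use x01 p in \<open>auto simp: b_def\<close>)
  also have "\<dots> = x * (1 + p * ?a * exp (- (n * p / 16)))" by (simp add: algebra_simps)
  also have "\<dots> \<le> exp (- p) ^ ?a * exp (p * ?a * exp (- (n * p / 16)))"
    unfolding x_def using p exp_ge_add_one_self[of "- p"] by (intro mult_mono power_mono) auto
  also have "\<dots> = exp (- (p * ?a) + p * ?a * exp (- (n * p / 16)))"
    unfolding exp_of_nat_mult[symmetric] exp_add[symmetric] by (simp add: mult.commute)
  finally show ?thesis .
qed

text \<open>If at most \<open>f\<close> features are good for \<open>A\<close>, meaning touched by
  \<open>A\<close> and with enough members outside it, then some \<open>F\<close> of size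
  \<open>f\<close> contains them and all other features fail independently. The union bound over
  \<open>A\<close> and \<open>F\<close> gives the two powers.\<close>

lemma prob_few_good_features:
  fixes p :: real
  assumes p: "0 \<le> p" "p \<le> 1/2" and a: "32 * a \<le> n" and f: "f \<le> m" "p * f \<le> 1"
    and large: "m * p * exp (- (n * p / 16)) \<le> 1"
  shows "measure_pmf.prob (incidence_pmf n m p)
      {R. \<exists>A\<in>{A. A \<subseteq> {..<n} \<and> card A = a}. \<exists>F\<in>{F. F \<subseteq> {..<m} \<and> card F = f}. \<forall>w\<in>{..<m} - F.
            (\<forall>v\<in>A. \<not> R (v, w)) \<or> real (card {v \<in> {..<n} - A. R (v, w)}) < n * p / 8}
      \<le> real (n ^ a) * (real (m ^ f) * exp (2 * real a - a * (m * p)))"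
proof -
  let ?B = "incidence_pmf n m p"
  let ?P = "\<lambda>A w R. (\<forall>v\<in>A. \<not> R (v, w)) \<or> real (card {v \<in> {..<n} - A. R (v, w)}) < n * p / 8"
  define e where "e = exp (- (n * p / 16))"
  have fixed: "measure_pmf.prob ?B {R. \<forall>w\<in>{..<m} - F. ?P A w R} \<le> exp (2 * real a - a * (m * p))"
    if A: "A \<subseteq> {..<n}" "card A = a" and F: "F \<subseteq> {..<m}" "card F = f" for A F
  proof -
    have "measure_pmf.prob ?B {R. \<forall>w\<in>{..<m} - F. ?P A w R}
        \<le> exp (- (p * a) + p * a * e) ^ card ({..<m} - F)"
    proof (rule prob_incidence_features)
      show "measure_pmf.prob ?B {R. ?P A w R} \<le> exp (- (p * a) + p * a * e)" if "w \<in> {..<m} - F" for w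
        using prob_untouched_or_small[OF p A(1), of w m] A(2) a that unfolding e_def by simp
      show "?P A w R = ?P A w R'" if "\<And>v. R (v, w) = R' (v, w)" for w R R'
        using that by simp
    qed auto
    also have "card ({..<m} - F) = m - f"
      using F by (subst card_Diff_subset) (auto intro: finite_subset)
    also have "exp (- (p * a) + p * a * e) ^ (m - f) = exp (real (m - f) * (- (p * a) + p * a * e))"
      by (rule exp_of_nat_mult[symmetric])
    also have "\<dots> \<le> exp (2 * real a - a * (m * p))"
    proof -
      \<comment> \<open>The loss \<open>2 * a\<close> has two sources: the excluded \<open>f\<close>
        features cost \<open>a\<close> since \<open>p * f \<le> 1\<close>, and the correction
        \<open>e\<close> costs \<open>a\<close> since \<open>m * p * e \<le> 1\<close>.\<close>
      have "real (m - f) * (- (p * a) + p * a * e) = real m * (- (p * a)) + a * (p * f) + a * (p * real (m - f) * e)"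
        using f by (simp add: of_nat_diff algebra_simps)
      also have "a * (p * f) \<le> real a * 1" using f by (intro mult_left_mono) auto
      also have "a * (p * real (m - f) * e) \<le> real a * 1"
      proof (rule mult_left_mono)
        have "p * real (m - f) * e \<le> p * m * e"
          using p by (intro mult_right_mono mult_left_mono) (auto simp: e_def)
        also have "\<dots> \<le> 1" using large by (simp add: e_def mult.commute)
        finally show "p * real (m - f) * e \<le> 1" .
      qed simp
      finally show ?thesis by (simp add: algebra_simps)
    qed
    finally show ?thesis .
  qed
  have "measure_pmf.prob ?B {R. \<exists>A\<in>{A. A \<subseteq> {..<n} \<and> card A = a}.
            \<exists>F\<in>{F. F \<subseteq> {..<m} \<and> card F = f}. \<forall>w\<in>{..<m} - F. ?P A w R}
      \<le> real (card {A. A \<subseteq> {..<n} \<and> card A = a}) *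
         (real (card {F. F \<subseteq> {..<m} \<and> card F = f}) * exp (2 * real a - a * (m * p)))"
    using fixed by (intro prob_pmf_bex_le_card) auto
  also have "\<dots> \<le> real (n ^ a) * (real (m ^ f) * exp (2 * real a - a * (m * p)))"
  proof -
    have "card {A. A \<subseteq> {..<n} \<and> card A = a} \<le> n ^ a"
      using n_subsets[of "{..<n}" a] binomial_le_pow[of a n] a by simp
    moreover have "card {F. F \<subseteq> {..<m} \<and> card F = f} \<le> m ^ f"
      using n_subsets[of "{..<m}" f] binomial_le_pow[of f m] f by simp
    ultimately show ?thesis
      by (intro mult_mono mult_nonneg_nonneg) (simp_all only: of_nat_le_iff of_nat_0_le_iff exp_ge_zero)
  qed
  finally show ?thesis .
qed

text \<open>If the features in \<open>F\<close> cover few vertices, all their members lie in a set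
  \<open>U\<close> of at most \<open>f * y / 16\<close> vertices, where \<open>y = n * p\<close>.
  The union bound runs over \<open>F\<close> and \<open>U\<close>; choosing \<open>U\<close> costs
  only about half of what the overcrowding of \<open>U\<close> gains.\<close>

lemma prob_good_features_overlap:
  fixes p :: real
  assumes p: "0 < p" "p \<le> 1" and f: "1 \<le> f" "f \<le> m" "f * p \<le> exp (- 64)"
  shows "measure_pmf.prob (incidence_pmf n m p)
      {R. \<exists>F\<in>{F. F \<subseteq> {..<m} \<and> card F = f}. (\<forall>w\<in>F. n * p / 8 \<le> card {v \<in> {..<n}. R (v, w)}) \<and>
            real (card (vertices_of n R F)) \<le> f * (n * p) / 16}
      \<le> (m * exp (- 2 * (n * p))) ^ f"
proof -
  let ?B = "incidence_pmf n m p"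
  define y where "y = n * p"
  define z where "z = f * p"
  define L where "L = ln z"
  define Us where "Us = {U. U \<subseteq> {..<n} \<and> real (card U) \<le> f * y / 16}"
  have z: "0 < z" "z \<le> exp (- 64)" using p f by (auto simp: z_def)
  have "exp (- 64) \<le> (1::real)" by simp
  then have z1: "z \<le> 1" using z by linarith
  have L: "L \<le> - 64" unfolding L_def using z by (metis ln_exp ln_le_cancel_iff exp_gt_zero)
  have fU: "finite Us" unfolding Us_def by (rule finite_subset[of _ "Pow {..<n}"]) auto
  have y: "0 \<le> y" using p by (simp add: y_def)
  have fixed: "measure_pmf.prob ?B {R. \<exists>U\<in>Us. \<forall>w\<in>F. y / 8 \<le> card {v \<in> U. R (v, w)}} \<le> exp (- 2 * y) ^ f"
    if F: "F \<subseteq> {..<m}" "card F = f" for F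
  proof -
    have one: "measure_pmf.prob ?B {R. \<forall>w\<in>F. y / 8 \<le> card {v \<in> U. R (v, w)}}
        \<le> exp (y / 8 * L + y / 16) ^ f" if U: "U \<in> Us" for U
    proof -
      have "measure_pmf.prob ?B {R. y / 8 \<le> card {v \<in> U. R (v, w)}} \<le> exp (y / 8 * L + y / 16)"
        if w: "w \<in> F" for w
      proof -
        \<comment> \<open>The base \<open>1 / z\<close> raises the mean number of members in
          \<open>U\<close> to \<open>card U / f\<close>, at most \<open>y / 16\<close> and so still
          half of the required number.\<close>
        have "measure_pmf.prob ?B {R. y / 8 \<le> card {v \<in> U. R (v, w)}}
            \<le> (1 / z) powr (- (y / 8)) * exp (p * (1 / z) * card (U \<times> {w}))"
          unfolding card_incidences[symmetric]
          using p z z1 U w F by (intro prob_bernoulli_family_card_ge) (auto simp: Us_def)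
        also have "(1 / z) powr (- (y / 8)) = exp (y / 8 * L)"
          using z by (simp add: powr_def L_def ln_div)
        also have "exp (p * (1 / z) * card (U \<times> {w})) \<le> exp (y / 16)"
        proof -
          have "p * (1 / z) * card (U \<times> {w}) = card U / f"
            using p by (simp add: z_def card_cartesian_product)
          also have "\<dots> \<le> y / 16" using U f by (simp add: Us_def field_simps)
          finally show ?thesis by simp
        qed
        finally show ?thesis by (simp add: exp_add)
      qed
      then have "measure_pmf.prob ?B {R. \<forall>w\<in>F. y / 8 \<le> card {v \<in> U. R (v, w)}}
          \<le> exp (y / 8 * L + y / 16) ^ card F"
        using F(1) by (intro prob_incidence_features) auto
      then show ?thesis using F(2) by simp
    qed
    have "measure_pmf.prob ?B {R. \<exists>U\<in>Us. \<forall>w\<in>F. y / 8 \<le> card {v \<in> U. R (v, w)}}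
        \<le> card Us * exp (y / 8 * L + y / 16) ^ f"
      by (rule prob_pmf_bex_le_card[OF fU one])
    also have "\<dots> \<le> z powr (- (f * y / 16)) * exp (z * card {..<n}) * exp (y / 8 * L + y / 16) ^ f"
      unfolding Us_def using z z1 by (intro mult_right_mono card_small_subsets_le) auto
    also have "\<dots> = exp (f * (y * (L / 16 + 17 / 16)))"
    proof -
      have pw: "z powr (- (f * y / 16)) = exp (- (f * y / 16) * L)"
        using z by (simp add: powr_def L_def)
      have zn: "z * card {..<n} = f * y" by (simp add: z_def y_def)
      show ?thesis unfolding pw zn exp_of_nat_mult[symmetric] exp_add[symmetric]
        by (simp add: field_simps)
    qed
    \<comment> \<open>With \<open>L \<le> - 64\<close> the bracket is at most
      \<open>- 47 / 16\<close>.\<close>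
    also have "\<dots> \<le> exp (f * (y * (- 2)))"
      using L y by (intro iffD2[OF exp_le_cancel_iff] mult_left_mono) auto
    also have "\<dots> = exp (- 2 * y) ^ f" by (subst exp_of_nat_mult[symmetric]) (simp add: mult.commute)
    finally show ?thesis .
  qed
  have "measure_pmf.prob ?B
      {R. \<exists>F\<in>{F. F \<subseteq> {..<m} \<and> card F = f}. (\<forall>w\<in>F. n * p / 8 \<le> card {v \<in> {..<n}. R (v, w)}) \<and>
            real (card (vertices_of n R F)) \<le> f * (n * p) / 16}
      \<le> measure_pmf.prob ?B {R. \<exists>F\<in>{F. F \<subseteq> {..<m} \<and> card F = f}.
            \<exists>U\<in>Us. \<forall>w\<in>F. y / 8 \<le> card {v \<in> U. R (v, w)}}"
  proof (rule prob_pmf_mono, elim bexE conjE)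
    fix R F assume F: "F \<in> {F. F \<subseteq> {..<m} \<and> card F = f}"
      and g: "\<forall>w\<in>F. n * p / 8 \<le> card {v \<in> {..<n}. R (v, w)}"
      and c: "real (card (vertices_of n R F)) \<le> f * (n * p) / 16"
    have "vertices_of n R F \<in> Us" using c by (auto simp: Us_def y_def vertices_of_def)
    moreover have "{v \<in> vertices_of n R F. R (v, w)} = {v \<in> {..<n}. R (v, w)}" if "w \<in> F" for w
      using that by (auto simp: vertices_of_def)
    ultimately show "\<exists>F\<in>{F. F \<subseteq> {..<m} \<and> card F = f}. \<exists>U\<in>Us. \<forall>w\<in>F. y / 8 \<le> card {v \<in> U. R (v, w)}"
      using F g by (intro bexI[of _ F] bexI[of _ "vertices_of n R F"]) (auto simp: y_def)
  qed
  also have "\<dots> \<le> card {F. F \<subseteq> {..<m} \<and> card F = f} * exp (- 2 * y) ^ f"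
    using fixed by (intro prob_pmf_bex_le_card) auto
  also have "\<dots> \<le> real (m ^ f) * exp (- 2 * y) ^ f"
    using n_subsets[of "{..<m}" f] binomial_le_pow[of f m] f
    by (intro mult_right_mono) (simp_all del: of_nat_power)
  also have "\<dots> = (m * exp (- 2 * (n * p))) ^ f" by (simp add: power_mult_distrib y_def)
  finally show ?thesis .
qed

text \<open>A set \<open>B\<close> touching at most half of the features avoids a set
  \<open>F\<close> of at least half of them. There are at most \<open>2 ^ n * 2 ^ m\<close> pairs,
  and each has at least \<open>s * m / 2\<close> incidences to miss.\<close>

lemma prob_few_features_touched:
  fixes p s :: real
  assumes p: "0 \<le> p" "p \<le> 1" and s: "0 \<le> s"
  shows "measure_pmf.prob (incidence_pmf n m p)
      {R. \<exists>B\<in>{B. B \<subseteq> {..<n} \<and> s < card B}. \<exists>F\<in>{F. F \<subseteq> {..<m} \<and> m \<le> 2 * card F}.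
            \<forall>x\<in>B \<times> F. \<not> R x}
      \<le> 2 ^ n * (2 ^ m * exp (- (p * s * m / 2)))"
proof -
  let ?B = "incidence_pmf n m p"
  have "measure_pmf.prob ?B {R. \<forall>x\<in>B \<times> F. \<not> R x} \<le> exp (- (p * s * m / 2))"
    if B: "B \<subseteq> {..<n}" "s < card B" and F: "F \<subseteq> {..<m}" "m \<le> 2 * card F" for B F
  proof -
    have "measure_pmf.prob ?B {R. \<forall>x\<in>B \<times> F. \<not> R x} = (1 - p) ^ card (B \<times> F)"
      using B F p by (intro prob_bernoulli_family_all_False) auto
    also have "\<dots> \<le> exp (- p) ^ card (B \<times> F)"
      using p exp_ge_add_one_self[of "- p"] by (intro power_mono) auto
    also have "\<dots> = exp (- (p * (real (card B) * card F)))"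
      unfolding exp_of_nat_mult[symmetric] by (simp add: card_cartesian_product)
    also have "\<dots> \<le> exp (- (p * s * m / 2))"
    proof -
      have "s * (m / 2) \<le> real (card B) * card F"
        using B F s by (intro mult_mono) (auto simp: field_simps)
      then have "p * (s * (m / 2)) \<le> p * (real (card B) * card F)" using p by (intro mult_left_mono)
      then show ?thesis by simp
    qed
    finally show ?thesis .
  qed
  then have "measure_pmf.prob ?B
      {R. \<exists>B\<in>{B. B \<subseteq> {..<n} \<and> s < card B}. \<exists>F\<in>{F. F \<subseteq> {..<m} \<and> m \<le> 2 * card F}. \<forall>x\<in>B \<times> F. \<not> R x}
     \<le> card {B. B \<subseteq> {..<n} \<and> s < card B} * (card {F. F \<subseteq> {..<m} \<and> m \<le> 2 * card F} * exp (- (p * s * m / 2)))"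
    by (intro prob_pmf_bex_le_card) auto
  also have "\<dots> \<le> 2 ^ n * (2 ^ m * exp (- (p * s * m / 2)))"
  proof -
    have c: "real (card X) \<le> 2 ^ j" if "X \<subseteq> Pow {..<j}" for j and X :: "nat set set"
    proof -
      have "card X \<le> 2 ^ j" using card_mono[OF _ that] by (simp add: card_Pow)
      then show ?thesis by (metis of_nat_le_iff of_nat_numeral of_nat_power)
    qed
    show ?thesis by (intro mult_mono c mult_nonneg_nonneg) auto
  qed
  finally show ?thesis .
qed

text \<open>Deterministic part: with \<open>y = n * p\<close> and \<open>f\<close> the integer part
  of \<open>64 * a / y\<close>, a small set \<open>A\<close> touches at least \<open>f + 1\<close>
  good features, and these together cover more than \<open>(f + 1) * y / 16\<close> vertices. Large
  sets are handled by taking the untouched features for \<open>F\<close>.\<close>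

lemma expandingI:
  fixes p s :: real
  assumes p: "0 < p" "p \<le> exp (- 64) / 2" and mp: "1 \<le> m * p" and k: "64 * real k \<le> n * p"
    and s: "s = n * exp (- 64) / 128"
    and few_good: "\<And>a A F. a \<in> {1..n} \<Longrightarrow> a \<le> s \<Longrightarrow> A \<subseteq> {..<n} \<Longrightarrow> card A = a \<Longrightarrow> F \<subseteq> {..<m} \<Longrightarrow>
      card F = nat \<lfloor>64 * a / (n * p)\<rfloor> \<Longrightarrow> \<exists>w\<in>{..<m} - F. \<not> ((\<forall>v\<in>A. \<not> R (v, w)) \<or>
         real (card {v \<in> {..<n} - A. R (v, w)}) < n * p / 8)"
    and overlap: "\<And>f F. f \<in> {1..m} \<Longrightarrow> f * p \<le> exp (- 64) \<Longrightarrow> F \<subseteq> {..<m} \<Longrightarrow> card F = f \<Longrightarrow>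
      (\<And>w. w \<in> F \<Longrightarrow> n * p / 8 \<le> card {v \<in> {..<n}. R (v, w)}) \<Longrightarrow>
      f * (n * p) / 16 < card (vertices_of n R F)"
    and touched: "\<And>B F. B \<subseteq> {..<n} \<Longrightarrow> s < card B \<Longrightarrow> F \<subseteq> {..<m} \<Longrightarrow> m \<le> 2 * card F \<Longrightarrow> \<exists>x\<in>B \<times> F. R x"
  shows "expanding n m k s R"
  unfolding expanding_def
proof (intro conjI allI impI; (elim conjE)?)
  fix A assume A: "A \<subseteq> {..<n}" "A \<noteq> {}" "real (card A) \<le> s"
  define a where "a = card A"
  define y where "y = n * p"
  define f where "f = nat \<lfloor>64 * a / y\<rfloor>"
  have fA: "finite A" using A finite_subset by blast
  have a: "1 \<le> a" "a \<le> n"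
    using A fA card_mono[of "{..<n}" A] by (auto simp: a_def Suc_le_eq card_gt_0_iff)
  have n: "0 < n" using a by simp
  have y: "0 < y" using n p by (simp add: y_def)
  have f1: "f * y \<le> 64 * a"
  proof -
    have "real f \<le> 64 * a / y" unfolding f_def using y by (simp add: le_floor_iff[symmetric] of_nat_nat)
    then show ?thesis using y by (simp add: field_simps)
  qed
  have f2: "64 * a < (f + 1) * y"
  proof -
    have "64 * a / y < real f + 1" unfolding f_def using y by linarith
    then show ?thesis using y by (simp add: field_simps)
  qed
  have e1: "exp (- 64 :: real) \<le> 1" by simp
  \<comment> \<open>The constant in \<open>s\<close> makes \<open>f * p\<close> at most
    \<open>exp (- 64) / 2\<close>; the bound on \<open>p\<close> leaves room for the additional
    feature in \<open>f + 1\<close>.\<close>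
  have small: "64 * real a \<le> n * (exp (- 64) / 2)" using A(3) by (simp add: s a_def)
  have fp: "f * p \<le> exp (- 64) / 2"
  proof -
    have "n * (f * p) \<le> n * (exp (- 64) / 2)" using f1 small by (simp add: y_def mult.left_commute)
    then show ?thesis using n by simp
  qed
  have fm: "f \<le> m"
  proof -
    have "f * p \<le> m * p" using fp e1 mp by linarith
    then show ?thesis using p by simp
  qed
  define G where "G = {w \<in> features_of m R A. n * p / 8 \<le> real (card {v \<in> {..<n} - A. R (v, w)})}"
  have Gm: "G \<subseteq> {..<m}" by (auto simp: G_def features_of_def)
  have "f < card G"
  proof (rule ccontr)
    assume "\<not> f < card G"
    \<comment> \<open>The set \<open>G\<close> of good features is padded to exactly
      \<open>f\<close> features, so that every feature outside \<open>F\<close> is bad.\<close>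
    then obtain F where F: "G \<subseteq> F" "F \<subseteq> {..<m}" "card F = f"
      using exists_subset_between[of G f "{..<m}"] Gm fm by auto
    have "real a \<le> s" using A(3) by (simp add: a_def)
    then have "\<exists>w\<in>{..<m} - F. \<not> ((\<forall>v\<in>A. \<not> R (v, w)) \<or>
         real (card {v \<in> {..<n} - A. R (v, w)}) < n * p / 8)"
      by (rule few_good[rotated]) (use a A(1) F in \<open>simp_all add: a_def f_def y_def\<close>)
    then obtain w where w: "w \<in> {..<m} - F"
      "\<not> ((\<forall>v\<in>A. \<not> R (v, w)) \<or> real (card {v \<in> {..<n} - A. R (v, w)}) < n * p / 8)"
      by (elim bexE)
    then have "w \<in> G" by (auto simp: G_def features_of_def)
    then show False using F w by blast
  qed
  then obtain F where F: "F \<subseteq> G" "card F = f + 1"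
    using obtain_subset_with_card_n[of "f + 1" G] by auto
  have "real (f + 1) * (n * p) / 16 < card (vertices_of n R F)"
  proof (rule overlap)
    show "f + 1 \<in> {1..m}" using \<open>f < card G\<close> card_mono[OF _ Gm] by simp
    show "real (f + 1) * p \<le> exp (- 64)" using fp p by (simp add: distrib_right)
    show "F \<subseteq> {..<m}" using F Gm by blast
    show "n * p / 8 \<le> card {v \<in> {..<n}. R (v, w)}" if "w \<in> F" for w
    proof -
      have "n * p / 8 \<le> real (card {v \<in> {..<n} - A. R (v, w)})" using that F by (auto simp: G_def)
      also have "\<dots> \<le> real (card {v \<in> {..<n}. R (v, w)})"
        by (intro of_nat_mono card_mono) auto
      finally show ?thesis .
    qed
  qed (rule F(2))
  also have "card (vertices_of n R F) \<le> card (vertices_of n R (features_of m R A))"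
    using F by (intro card_mono) (auto simp: vertices_of_def G_def)
  finally have big: "(f + 1) * y / 16 < card (vertices_of n R (features_of m R A))" by (simp add: y_def)
  \<comment> \<open>The cover exceeds \<open>4 * a\<close> by the choice of \<open>f\<close> and is
    at least \<open>4 * k\<close> since \<open>y \<ge> 64 * k\<close>; three quarters of the first
    and one quarter of the second give \<open>3 * a + k\<close>.\<close>
  have "y \<le> (f + 1) * y" using y by (simp add: distrib_right)
  then show "3 * card A + k \<le> card (vertices_of n R (features_of m R A))"
    using big f2 k unfolding a_def[symmetric] y_def[symmetric] by linarith
next
  fix B assume B: "B \<subseteq> {..<n}" "s < real (card B)"
  show "m < 2 * card (features_of m R B)"
  proof (rule ccontr)
    let ?F = "{..<m} - features_of m R B"
    assume c: "\<not> m < 2 * card (features_of m R B)"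
    have "card ?F = m - card (features_of m R B)"
      by (subst card_Diff_subset) (auto simp: features_of_def)
    then have "\<exists>x\<in>B \<times> ?F. R x" using c by (intro touched[OF B]) auto
    then show False by (auto simp: features_of_def)
  qed
qed

lemma exp_1_ge_2: "(2::real) \<le> exp 1"
  using exp_ge_add_one_self[of 1] by simp

text \<open>The three summands bound the failure of the three conditions for expansion. The first
  two are geometric series, over the size of \<open>A\<close> and of the feature set; the third is a
  single union bound.\<close>

lemma prob_not_expanding:
  fixes p :: real
  assumes p: "0 < p" "p \<le> exp (- 64) / 2" and n: "2 \<le> n" "m \<le> n"
    and large: "ln n + 67 \<le> m * p" and dec: "m * p * exp (- (n * p / 16)) \<le> 1"
    and k: "64 * real k \<le> n * p"
  shows "measure_pmf.prob (incidence_pmf n m p) {R. \<not> expanding n m k (n * exp (- 64) / 128) R}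
      \<le> 2 * exp (66 + ln n - m * p) + 2 / n + exp (n * (2 - m * p * exp (- 64) / 256))"
proof -
  let ?B = "incidence_pmf n m p"
  define s where "s = n * exp (- 64) / 128"
  define y where "y = n * p"
  define r where "r = exp (66 + ln n - m * p)"
  define fa where "fa = (\<lambda>a. nat \<lfloor>64 * real a / y\<rfloor>)"
  define E1 where "E1 = (\<lambda>R. \<exists>a\<in>{a \<in> {1..n}. a \<le> s}. \<exists>A\<in>{A. A \<subseteq> {..<n} \<and> card A = a}.
    \<exists>F\<in>{F. F \<subseteq> {..<m} \<and> card F = fa a}. \<forall>w\<in>{..<m} - F.
            (\<forall>v\<in>A. \<not> R (v, w)) \<or> real (card {v \<in> {..<n} - A. R (v, w)}) < n * p / 8)"
  define E2 where "E2 = (\<lambda>R. \<exists>f\<in>{f \<in> {1..m}. f * p \<le> exp (- 64)}.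
    \<exists>F\<in>{F. F \<subseteq> {..<m} \<and> card F = f}. (\<forall>w\<in>F. n * p / 8 \<le> card {v \<in> {..<n}. R (v, w)}) \<and>
            real (card (vertices_of n R F)) \<le> f * (n * p) / 16)"
  define E3 where "E3 = (\<lambda>R. \<exists>B\<in>{B. B \<subseteq> {..<n} \<and> s < card B}.
    \<exists>F\<in>{F. F \<subseteq> {..<m} \<and> m \<le> 2 * card F}. \<forall>x\<in>B \<times> F. \<not> (R x :: bool))"
  have e1: "exp (- 64 :: real) \<le> 1" by simp
  have lnn: "0 \<le> ln (real n)" using n by simp
  have y: "m * p \<le> y" "ln n \<le> y" "0 < y"
  proof -
    show *: "m * p \<le> y" using n p by (simp add: y_def)
    show "ln n \<le> y" using * large by linarith
    show "0 < y" using * large lnn by linarith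
  qed
  have p2: "p \<le> 1/2" using p e1 by linarith

  have "measure_pmf.prob ?B {R. E1 R} \<le> (\<Sum>a\<in>{a \<in> {1..n}. a \<le> s}. r ^ a)"
    unfolding E1_def
  proof (rule order_trans[OF prob_pmf_bex_le sum_mono])
    fix a assume "a \<in> {a \<in> {1..n}. a \<le> s}"
    then have a: "1 \<le> a" "real a \<le> s" by auto
    have small: "128 * real a \<le> n * exp (- 64)" using a by (simp add: s_def)
    also have "\<dots> \<le> real n * 1" using e1 by (intro mult_left_mono) auto
    finally have an: "128 * real a \<le> n" by simp
    have fy: "fa a \<le> 64 * a / y" unfolding fa_def using y by (simp add: le_floor_iff[symmetric] of_nat_nat)
    have fp: "fa a * p \<le> 1"
    proof -
      have "n * (fa a * p) \<le> 64 * real a" using fy y(3) by (simp add: y_def field_simps)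
      then have "n * (fa a * p) \<le> n * 1" using an by linarith
      then show ?thesis using n by (simp add: mult_le_cancel_left_pos)
    qed
    have fm: "fa a \<le> m"
    proof -
      have "fa a * p \<le> m * p" using fp large lnn by linarith
      then show ?thesis using p by simp
    qed
    have "measure_pmf.prob ?B {R. \<exists>A\<in>{A. A \<subseteq> {..<n} \<and> card A = a}.
        \<exists>F\<in>{F. F \<subseteq> {..<m} \<and> card F = fa a}. \<forall>w\<in>{..<m} - F.
            (\<forall>v\<in>A. \<not> R (v, w)) \<or> real (card {v \<in> {..<n} - A. R (v, w)}) < n * p / 8}
        \<le> real (n ^ a) * (real (m ^ fa a) * exp (2 * real a - a * (m * p)))"
      using p p2 an fm fp dec by (intro prob_few_good_features) (auto simp: mult.commute)
    also have "\<dots> \<le> exp (a * ln n) * (exp (64 * a) * exp (2 * real a - a * (m * p)))"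
    proof (intro mult_mono order_refl)
      show "real (n ^ a) \<le> exp (a * ln n)" using n by (simp add: exp_of_nat_mult)
      show "real (m ^ fa a) \<le> exp (64 * a)"
      proof (cases "m = 0")
        case True
        then show ?thesis using fm by simp
      next
        case False
        then have "real (m ^ fa a) = exp (fa a * ln m)" by (simp add: exp_of_nat_mult)
        \<comment> \<open>Since \<open>ln m \<le> ln n \<le> y\<close>, the choice of the feature
          set costs only a factor \<open>exp 64\<close> per vertex of \<open>A\<close>.\<close>
        also have "fa a * ln m \<le> 64 * a / y * y"
        proof (intro mult_mono fy)
          have "ln (real m) \<le> ln n" using False n by simp
          then show "ln (real m) \<le> y" using y by linarith
        qed (use False y in auto)
        then have "exp (fa a * ln m) \<le> exp (64 * a)" using y(3) by simp
        finally show ?thesis .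
      qed
    qed auto
    also have "\<dots> = r ^ a"
      unfolding r_def exp_of_nat_mult[symmetric] exp_add[symmetric] by (simp add: algebra_simps)
    finally show "measure_pmf.prob ?B {R. \<exists>A\<in>{A. A \<subseteq> {..<n} \<and> card A = a}.
        \<exists>F\<in>{F. F \<subseteq> {..<m} \<and> card F = fa a}. \<forall>w\<in>{..<m} - F.
            (\<forall>v\<in>A. \<not> R (v, w)) \<or> real (card {v \<in> {..<n} - A. R (v, w)}) < n * p / 8} \<le> r ^ a" .
  qed simp
  also have "\<dots> \<le> (\<Sum>a=1..n. r ^ a)" by (intro sum_mono2) (auto simp: r_def)
  also have "\<dots> \<le> 2 * r"
  proof (rule sum_power_le_twice)
    \<comment> \<open>The constant 67 is 64 for the choice of features, 2 for the loss in the
      exponent, and 1 to bring the ratio below one half.\<close>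
    have "r \<le> exp (- 1)" unfolding r_def using large by simp
    also have "\<dots> \<le> 1 / 2" using exp_1_ge_2 by (simp add: exp_minus field_simps)
    finally show "r \<le> 1 / 2" .
  qed (simp add: r_def)
  finally have P1: "measure_pmf.prob ?B {R. E1 R} \<le> 2 * r" .

  have "measure_pmf.prob ?B {R. E2 R} \<le> (\<Sum>f\<in>{f \<in> {1..m}. f * p \<le> exp (- 64)}. (1 / real n) ^ f)"
    unfolding E2_def
  proof (rule order_trans[OF prob_pmf_bex_le sum_mono])
    fix f assume f: "f \<in> {f \<in> {1..m}. f * p \<le> exp (- 64)}"
    \<comment> \<open>Here \<open>m \<le> n\<close> and \<open>n * p \<ge> ln n\<close>, so the
      ratio is at most \<open>n / n ^ 2\<close>.\<close>
    have "m * exp (- 2 * (n * p)) \<le> real n * exp (- 2 * ln n)"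
      using n y by (intro mult_mono) (auto simp: y_def)
    also have "exp (- 2 * ln n) = 1 / real n ^ 2"
    proof -
      have "exp (2 * ln (real n)) = real n ^ 2" using exp_of_nat_mult[of 2 "ln (real n)"] n by simp
      then show ?thesis by (simp add: exp_minus field_simps)
    qed
    also have "real n * (1 / real n ^ 2) = 1 / n" using n by (simp add: power2_eq_square)
    finally have mn: "m * exp (- 2 * (n * p)) \<le> 1 / n" .
    have "measure_pmf.prob ?B {R. \<exists>F\<in>{F. F \<subseteq> {..<m} \<and> card F = f}.
        (\<forall>w\<in>F. n * p / 8 \<le> card {v \<in> {..<n}. R (v, w)}) \<and>
            real (card (vertices_of n R F)) \<le> f * (n * p) / 16} \<le> (m * exp (- 2 * (n * p))) ^ f"
      using p p2 f by (intro prob_good_features_overlap) auto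
    also have "\<dots> \<le> (1 / real n) ^ f" using mn by (intro power_mono) auto
    finally show "measure_pmf.prob ?B {R. \<exists>F\<in>{F. F \<subseteq> {..<m} \<and> card F = f}.
        (\<forall>w\<in>F. n * p / 8 \<le> card {v \<in> {..<n}. R (v, w)}) \<and>
            real (card (vertices_of n R F)) \<le> f * (n * p) / 16} \<le> (1 / real n) ^ f" .
  qed simp
  also have "\<dots> \<le> (\<Sum>f=1..m. (1 / real n) ^ f)" by (intro sum_mono2) auto
  also have "\<dots> \<le> 2 * (1 / real n)" using n by (intro sum_power_le_twice) (auto simp: field_simps)
  finally have P2: "measure_pmf.prob ?B {R. E2 R} \<le> 2 / n" by simp

  have "measure_pmf.prob ?B {R. E3 R} \<le> 2 ^ n * (2 ^ m * exp (- (p * s * m / 2)))"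
    unfolding E3_def using p p2 by (intro prob_few_features_touched) (auto simp: s_def)
  also have "\<dots> \<le> exp n * (exp n * exp (- (p * s * m / 2)))"
  proof -
    have e: "(2::real) ^ j \<le> exp j" for j
      using power_mono[OF exp_1_ge_2, of j] by (simp flip: exp_of_nat_mult)
    have "(2::real) ^ m \<le> exp n" by (rule order_trans[OF e]) (use n in simp)
    then show ?thesis by (intro mult_mono e) auto
  qed
  also have "\<dots> = exp (n * (2 - m * p * exp (- 64) / 256))"
    unfolding exp_add[symmetric] by (simp add: s_def algebra_simps)
  finally have P3: "measure_pmf.prob ?B {R. E3 R} \<le> exp (n * (2 - m * p * exp (- 64) / 256))" .

  have "measure_pmf.prob ?B {R. \<not> expanding n m k s R} \<le> measure_pmf.prob ?B {R. E1 R \<or> E2 R \<or> E3 R}"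
  proof (rule prob_pmf_mono, rule ccontr)
    fix R assume ne: "\<not> expanding n m k s R" and "\<not> (E1 R \<or> E2 R \<or> E3 R)"
    then have E: "\<not> E1 R" "\<not> E2 R" "\<not> E3 R" by auto
    have "expanding n m k s R"
    proof (rule expandingI[OF p _ k s_def])
      show "1 \<le> m * p" using large lnn by linarith
      fix a A F
      assume "a \<in> {1..n}" "real a \<le> s" "A \<subseteq> {..<n}" "card A = a" "F \<subseteq> {..<m}"
        "card F = nat \<lfloor>64 * real a / (n * p)\<rfloor>"
      then show "\<exists>w\<in>{..<m} - F. \<not> ((\<forall>v\<in>A. \<not> R (v, w)) \<or>
         real (card {v \<in> {..<n} - A. R (v, w)}) < n * p / 8)"
        using E(1) unfolding E1_def fa_def y_def by blast
    next
      fix f F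
      assume f: "f \<in> {1..m}" "real f * p \<le> exp (- 64)" and F: "F \<subseteq> {..<m}" "card F = f"
        and g: "\<And>w. w \<in> F \<Longrightarrow> n * p / 8 \<le> card {v \<in> {..<n}. R (v, w)}"
      show "f * (n * p) / 16 < card (vertices_of n R F)"
      proof (rule ccontr)
        assume "\<not> f * (n * p) / 16 < card (vertices_of n R F)"
        then have "E2 R" unfolding E2_def
          using f F g by (intro bexI[of _ f] bexI[of _ F] conjI ballI) simp_all
        with E(2) show False by contradiction
      qed
    next
      fix B F
      assume "B \<subseteq> {..<n}" "s < card B" "F \<subseteq> {..<m}" "m \<le> 2 * card F"
      then show "\<exists>x\<in>B \<times> F. R x" using E(3) unfolding E3_def by blast
    qed
    with ne show False by blast
  qed
  also have "\<dots> \<le> measure_pmf.prob ?B {R. E1 R} + (measure_pmf.prob ?B {R. E2 R} + measure_pmf.prob ?B {R. E3 R})"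
    by (rule order_trans[OF prob_pmf_disj_le add_left_mono[OF prob_pmf_disj_le]])
  finally show ?thesis using P1 P2 P3 unfolding s_def r_def by linarith
qed

section \<open>Limits\<close>

lemma prob_random_intersection_graph:
  "measure_pmf.prob (random_intersection_graph n m p) {G. P G} =
   measure_pmf.prob (incidence_pmf n m p) {R. P (intersection_graph n m R)}"
  by (simp add: random_intersection_graph_def vimage_def)

lemma feature_set_eq_empty_iff: "feature_set m R v = {} \<longleftrightarrow> (\<forall>x\<in>{v} \<times> {..<m}. \<not> R x)"
  by (auto simp: feature_set_def)

text \<open>Feature sets of different vertices are independent, so the probability is exactly
  \<open>(1 - (1 - p) ^ m) ^ n\<close>. The estimate
  \<open>1 - p \<ge> exp (- p - 2 * p ^ 2)\<close> for \<open>p \<le> 1 / 2\<close> then keeps the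
  first-order term sharp.\<close>

lemma prob_no_isolated_vertex_le:
  fixes p :: real
  assumes p: "0 \<le> p" "p \<le> 1/2"
  shows "measure_pmf.prob (incidence_pmf n m p) {R. \<forall>v\<in>{..<n}. feature_set m R v \<noteq> {}}
    \<le> exp (- (n * exp (- (m * (p + 2 * p\<^sup>2)))))"
proof -
  let ?B = "incidence_pmf n m p"
  have one: "measure_pmf.prob ?B {R. feature_set m R v \<noteq> {}} = 1 - (1 - p) ^ m" if "v < n" for v
    unfolding prob_pmf_neg feature_set_eq_empty_iff
    using p that by (subst prob_bernoulli_family_all_False) (auto simp: card_cartesian_product)
  have "measure_pmf.prob ?B {R. \<forall>v\<in>{..<n}. feature_set m R v \<noteq> {}} =
        (\<Prod>v\<in>{..<n}. measure_pmf.prob ?B {R. feature_set m R v \<noteq> {}})"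
  proof (rule prob_Pi_pmf_ball[where S = "\<lambda>v. {v} \<times> UNIV"])
    show "(feature_set m R v \<noteq> {}) = (feature_set m R' v \<noteq> {})"
      if "\<And>x. x \<in> {v} \<times> UNIV \<Longrightarrow> R x = R' x" for v R R'
      using that by (simp add: feature_set_def)
  qed (auto simp: disjoint_family_on_def)
  also have "\<dots> = (1 - (1 - p) ^ m) ^ n" using one by simp
  also have "\<dots> \<le> exp (- ((1 - p) ^ m)) ^ n"
    using p exp_ge_add_one_self[of "- ((1 - p) ^ m)"]
    by (intro power_mono) (auto simp: power_le_one)
  also have "\<dots> = exp (- (n * (1 - p) ^ m))" by (simp flip: exp_of_nat_mult)
  also have "\<dots> \<le> exp (- (n * exp (- (m * (p + 2 * p\<^sup>2)))))"
  proof -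
    have "exp (- p - 2 * p\<^sup>2) \<le> exp (ln (1 - p))"
      by (rule iffD2[OF exp_le_cancel_iff ln_one_minus_pos_lower_bound[OF p]])
    also have "\<dots> = 1 - p" using p by simp
    finally have "exp (- p - 2 * p\<^sup>2) \<le> 1 - p" .
    then have "exp (- p - 2 * p\<^sup>2) ^ m \<le> (1 - p) ^ m" by (intro power_mono) auto
    also have "exp (- p - 2 * p\<^sup>2) ^ m = exp (- (m * (p + 2 * p\<^sup>2)))"
      unfolding exp_of_nat_mult[symmetric] by (simp add: algebra_simps)
    finally show ?thesis by (simp add: mult_left_mono)
  qed
  finally show ?thesis .
qed

lemma tendsto_prob_1_if_implied:
  assumes Q: "(\<lambda>n. measure_pmf.prob (M n) {x. \<not> Q n x}) \<longlonglongrightarrow> 0"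
    and imp: "\<forall>\<^sub>F n in sequentially. \<forall>x. Q n x \<longrightarrow> P n x"
  shows "(\<lambda>n. measure_pmf.prob (M n) {x. P n x}) \<longlonglongrightarrow> 1"
proof (rule real_tendsto_sandwich[where f = "\<lambda>n. 1 - measure_pmf.prob (M n) {x. \<not> Q n x}" and h = "\<lambda>_. 1"])
  show "\<forall>\<^sub>F n in sequentially. 1 - measure_pmf.prob (M n) {x. \<not> Q n x} \<le> measure_pmf.prob (M n) {x. P n x}"
    using imp
  proof eventually_elim
    case (elim n)
    then have "measure_pmf.prob (M n) {x. Q n x} \<le> measure_pmf.prob (M n) {x. P n x}"
      by (intro prob_pmf_mono) auto
    then show ?case by (simp add: prob_pmf_neg)
  qed
  show "(\<lambda>n. 1 - measure_pmf.prob (M n) {x. \<not> Q n x}) \<longlonglongrightarrow> 1"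
    using tendsto_diff[OF tendsto_const[of 1] Q] by simp
qed auto

text \<open>The hypothesis admits any rounding of \<open>n powr \<alpha>\<close>. The bound by the
  squared logarithm controls the second-order term \<open>m * p ^ 2\<close> and yields the last
  limit by comparison with \<open>1 / ln n\<close>.\<close>

lemma number_of_features_asymptotics:
  fixes m :: "nat \<Rightarrow> nat"
  assumes "0 < \<alpha>" "\<alpha> \<le> 1" and m: "\<And>n. \<bar>real (m n) - real n powr \<alpha>\<bar> < 1"
  shows "\<forall>\<^sub>F n in sequentially. m n \<le> n"
    and "filterlim (\<lambda>n. real (m n)) at_top sequentially"
    and "\<forall>\<^sub>F n in sequentially. (ln (real n))\<^sup>2 \<le> real (m n)"
    and "(\<lambda>n. ln (real n) / m n) \<longlonglongrightarrow> 0"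
proof -
  have lower: "real n powr \<alpha> - 1 \<le> m n" for n using m[of n] by linarith
  show "\<forall>\<^sub>F n in sequentially. m n \<le> n"
    using eventually_ge_at_top[of 1]
  proof eventually_elim
    case (elim n)
    then have "real n powr \<alpha> \<le> real n powr 1" using assms(2) by (intro powr_mono) auto
    then have "real (m n) < real n + 1" using m[of n] elim by (simp add: abs_less_iff)
    then show ?case by linarith
  qed
  have "filterlim (\<lambda>n. real n powr \<alpha> - 1) at_top sequentially" using assms(1) by real_asymp
  then show lim: "filterlim (\<lambda>n. real (m n)) at_top sequentially"
    by (rule filterlim_at_top_mono) (simp add: lower)
  have "\<forall>\<^sub>F n in sequentially. (ln (real n))\<^sup>2 \<le> real n powr \<alpha> - 1" using assms(1) by real_asymp
  then show sq: "\<forall>\<^sub>F n in sequentially. (ln (real n))\<^sup>2 \<le> real (m n)"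
    by eventually_elim (use lower order_trans in blast)
  show "(\<lambda>n. ln (real n) / m n) \<longlonglongrightarrow> 0"
  proof (rule real_tendsto_sandwich[where f = "\<lambda>_. 0" and h = "\<lambda>n::nat. 1 / ln (real n)"])
    show "\<forall>\<^sub>F n in sequentially. ln (real n) / m n \<le> 1 / ln (real n)"
      using sq eventually_ge_at_top[of 2]
    proof eventually_elim
      case (elim n)
      then have l: "0 < ln (real n)" by simp
      then have "0 < real (m n)" using elim(1) by (meson less_le_trans zero_less_power)
      then show ?case using l elim(1) by (simp add: field_simps power2_eq_square)
    qed
    show "(\<lambda>n::nat. 1 / ln (real n)) \<longlonglongrightarrow> 0" by real_asymp
    show "\<forall>\<^sub>F n in sequentially. 0 \<le> ln (real n) / real (m n)"
      using eventually_ge_at_top[of 1] by eventually_elim simp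
  qed simp
qed

text \<open>Once \<open>w \<le> 0\<close>, \<open>p \<le> ln n / m\<close> and hence
  \<open>m * p ^ 2 \<le> (ln n) ^ 2 / m \<le> 1\<close>. Then
  \<open>n * exp (- m * (p + 2 * p ^ 2))\<close> is at least \<open>exp (- w - 2)\<close>, which
  tends to infinity.\<close>

lemma prob_no_isolated_vertex_tendsto_0:
  fixes m :: "nat \<Rightarrow> nat" and p w :: "nat \<Rightarrow> real"
  assumes \<alpha>: "0 < \<alpha>" "\<alpha> \<le> 1" and m: "\<And>n. \<bar>real (m n) - real n powr \<alpha>\<bar> < 1"
    and w: "filterlim w at_bot sequentially" and p: "\<And>n. p n = (ln (real n) + w n) / m n"
    and p01: "\<forall>\<^sub>F n in sequentially. p n \<in> {0..1}"
  shows "(\<lambda>n. measure_pmf.prob (incidence_pmf n (m n) (p n))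
            {R. \<not> (\<exists>v<n. feature_set (m n) R v = {})}) \<longlonglongrightarrow> 0"
proof (rule real_tendsto_sandwich[where f = "\<lambda>_. 0" and h = "\<lambda>n. exp (- exp (- w n - 2))"])
  note as = number_of_features_asymptotics[OF \<alpha> m]
  have m0: "\<forall>\<^sub>F n in sequentially. 0 < real (m n)"
    using as(2) unfolding filterlim_at_top_dense by blast
  have w0: "\<forall>\<^sub>F n in sequentially. w n \<le> 0" using w unfolding filterlim_at_bot by blast
  have half: "\<forall>\<^sub>F n in sequentially. ln (real n) / m n < 1/2"
    using as(4) by (rule order_tendstoD) simp
  show "\<forall>\<^sub>F n in sequentially. measure_pmf.prob (incidence_pmf n (m n) (p n))
            {R. \<not> (\<exists>v<n. feature_set (m n) R v = {})} \<le> exp (- exp (- w n - 2))"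
    using p01 m0 w0 as(3) half eventually_ge_at_top[of 2]
  proof eventually_elim
    case (elim n)
    have mp: "m n * p n = ln n + w n" using elim by (simp add: p)
    have pl: "p n \<le> ln n / m n" using elim by (simp add: p divide_right_mono)
    have "m n * (p n)\<^sup>2 \<le> m n * (ln n / m n)\<^sup>2"
      using elim pl by (intro mult_left_mono power_mono) auto
    also have "\<dots> = (ln n)\<^sup>2 / m n" using elim by (simp add: power2_eq_square)
    also have "\<dots> \<le> 1" using elim by simp
    finally have mp2: "m n * (p n)\<^sup>2 \<le> 1" .
    have "measure_pmf.prob (incidence_pmf n (m n) (p n)) {R. \<not> (\<exists>v<n. feature_set (m n) R v = {})}
        = measure_pmf.prob (incidence_pmf n (m n) (p n)) {R. \<forall>v\<in>{..<n}. feature_set (m n) R v \<noteq> {}}"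
      by (rule arg_cong[where f = "measure_pmf.prob _"]) auto
    also have "\<dots> \<le> exp (- (n * exp (- (m n * (p n + 2 * (p n)\<^sup>2)))))"
    proof (rule prob_no_isolated_vertex_le)
      show "p n \<le> 1 / 2" using pl elim(5) by linarith
    qed (use elim in simp)
    also have "n * exp (- (m n * (p n + 2 * (p n)\<^sup>2))) = exp (- w n - 2 * (m n * (p n)\<^sup>2))"
    proof -
      have "n * exp (- (m n * (p n + 2 * (p n)\<^sup>2))) = exp (ln n + - (m n * (p n + 2 * (p n)\<^sup>2)))"
        using elim by (simp only: exp_add) simp
      also have "ln n + - (m n * (p n + 2 * (p n)\<^sup>2)) = - w n - 2 * (m n * (p n)\<^sup>2)"
        using mp by (simp add: distrib_left)
      finally show ?thesis .
    qed
    also have "exp (- exp (- w n - 2 * (m n * (p n)\<^sup>2))) \<le> exp (- exp (- w n - 2))"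
      using mp2 by simp
    finally show ?case .
  qed
  have "((\<lambda>x. exp (- exp (- x - 2))) \<longlongrightarrow> (0::real)) at_bot" by real_asymp
  from filterlim_compose[OF this w] show "(\<lambda>n. exp (- exp (- w n - 2))) \<longlonglongrightarrow> 0" .
qed auto

text \<open>The cap \<open>v \<le> ln n\<close> keeps \<open>p\<close> below
  \<open>2 * ln n / m\<close>, which tends to 0, so the finite bound applies eventually.
  Substituting \<open>m * p = ln n + v\<close> turns its first term into a multiple of
  \<open>exp (66 - v)\<close>.\<close>

lemma prob_not_expanding_tendsto_0:
  fixes m :: "nat \<Rightarrow> nat" and p v :: "nat \<Rightarrow> real"
  assumes \<alpha>: "0 < \<alpha>" "\<alpha> \<le> 1" and m: "\<And>n. \<bar>real (m n) - real n powr \<alpha>\<bar> < 1"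
    and v: "filterlim v at_top sequentially" "\<And>n. v n \<le> ln (real n)"
    and p: "\<And>n. p n = (ln (real n) + v n) / m n"
  shows "(\<lambda>n. measure_pmf.prob (incidence_pmf n (m n) (p n))
            {R. \<not> expanding n (m n) k (n * exp (- 64) / 128) R}) \<longlonglongrightarrow> 0"
    and "\<forall>\<^sub>F n in sequentially. 0 < p n"
proof -
  note as = number_of_features_asymptotics[OF \<alpha> m]
  have m0: "\<forall>\<^sub>F n in sequentially. 0 < real (m n)"
    using as(2) unfolding filterlim_at_top_dense by blast
  have v67: "\<forall>\<^sub>F n in sequentially. 67 \<le> v n" using v(1) unfolding filterlim_at_top by blast
  have small: "\<forall>\<^sub>F n in sequentially. ln (real n) / m n < exp (- 64) / 4"
    using as(4) by (rule order_tendstoD) simp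
  have "((\<lambda>x::real. x * exp (- x / 16)) \<longlongrightarrow> 0) at_top" by real_asymp
  then have "\<forall>\<^sub>F x::real in at_top. x * exp (- x / 16) < 1" by (rule order_tendstoD) simp
  then obtain X :: real where X: "\<And>x. x \<ge> X \<Longrightarrow> x * exp (- x / 16) < 1"
    by (auto simp: eventually_at_top_linorder)
  have lnX: "\<forall>\<^sub>F n::nat in sequentially. max X (64 * real k) \<le> ln (real n)"
  proof -
    have "filterlim (\<lambda>n::nat. ln (real n)) at_top sequentially" by real_asymp
    then show ?thesis unfolding filterlim_at_top by blast
  qed
  show "\<forall>\<^sub>F n in sequentially. 0 < p n"
    using m0 v67 eventually_ge_at_top[of 2]
    by eventually_elim (auto simp: p intro!: divide_pos_pos add_nonneg_pos)
  define h where "h = (\<lambda>n. 2 * exp (66 - v n) + 2 / real n + exp (n * (2 - ln (real n) * exp (- 64) / 256)))"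
  show "(\<lambda>n. measure_pmf.prob (incidence_pmf n (m n) (p n))
            {R. \<not> expanding n (m n) k (n * exp (- 64) / 128) R}) \<longlonglongrightarrow> 0"
  proof (rule real_tendsto_sandwich[where f = "\<lambda>_. 0" and h = h])
    show "\<forall>\<^sub>F n in sequentially. measure_pmf.prob (incidence_pmf n (m n) (p n))
            {R. \<not> expanding n (m n) k (n * exp (- 64) / 128) R} \<le> h n"
      using as(1) m0 v67 small lnX \<open>\<forall>\<^sub>F n in sequentially. 0 < p n\<close> eventually_ge_at_top[of 2]
    proof eventually_elim
      case (elim n)
      have mp: "m n * p n = ln n + v n" using elim by (simp add: p)
      have mn: "m n * p n \<le> n * p n" using elim by (intro mult_right_mono) auto
      have le: "p n \<le> exp (- 64) / 2"
      proof -
        have "p n \<le> (2 * ln n) / m n" unfolding p using v(2)[of n] elim by (intro divide_right_mono) auto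
        also have "\<dots> = 2 * (ln n / m n)" by simp
        also have "\<dots> \<le> 2 * (exp (- 64) / 4)" by (rule mult_left_mono[OF less_imp_le[OF elim(4)]]) simp
        finally show ?thesis by simp
      qed
      have "measure_pmf.prob (incidence_pmf n (m n) (p n))
            {R. \<not> expanding n (m n) k (n * exp (- 64) / 128) R}
          \<le> 2 * exp (66 + ln n - m n * p n) + 2 / n + exp (n * (2 - m n * p n * exp (- 64) / 256))"
      proof (rule prob_not_expanding)
        \<comment> \<open>The decay condition is reduced to the single variable
          \<open>x = m * p\<close> by means of \<open>m * p \<le> n * p\<close>.\<close>
        have "m n * p n * exp (- (n * p n / 16)) \<le> m n * p n * exp (- (m n * p n) / 16)"
          using mn elim by (intro mult_left_mono) auto
        also have "\<dots> \<le> 1" using X[of "m n * p n"] elim mp by simp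
        finally show "m n * p n * exp (- (n * p n / 16)) \<le> 1" .
        show "64 * real k \<le> n * p n" using mn mp elim by simp
      qed (use elim le mp in auto)
      also have "\<dots> \<le> h n"
      proof -
        have "ln n * exp (- 64) \<le> m n * p n * exp (- 64)" using mp elim by (intro mult_right_mono) auto
        then have "n * (2 - m n * p n * exp (- 64) / 256) \<le> n * (2 - ln n * exp (- 64) / 256)"
          by (intro mult_left_mono) auto
        then show ?thesis using mp by (simp add: h_def)
      qed
      finally show ?case .
    qed
    show "h \<longlonglongrightarrow> 0"
    proof -
      have "((\<lambda>x::real. exp (66 - x)) \<longlongrightarrow> 0) at_top" by real_asymp
      from filterlim_compose[OF this v(1)] have 1: "(\<lambda>n. exp (66 - v n)) \<longlonglongrightarrow> 0" .
      have 2: "(\<lambda>n::nat. 2 / real n) \<longlonglongrightarrow> 0" by real_asymp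
      have c: "0 < exp (- 64 :: real)" by simp
      have 3: "(\<lambda>n::nat. exp (n * (2 - ln (real n) * c / 256))) \<longlonglongrightarrow> 0" if "0 < c" for c :: real
        using that by real_asymp
      show ?thesis
        unfolding h_def using tendsto_add[OF tendsto_add[OF tendsto_mult[OF tendsto_const[of 2] 1] 2] 3[OF c]]
        by simp
    qed
  qed auto
qed

text \<open>For \<open>n \<ge> 3\<close>, which exceeds \<open>exp 1\<close>, the iterated logarithm
  is nonnegative and only increases the numerator.\<close>

lemma p_rig_ge:
  assumes "1 \<le> j" "3 \<le> n"
  shows "(ln (real n) + \<omega> n) / real (m n) \<le> p_rig \<omega> m j n"
proof -
  have "exp 1 \<le> (3::real)" by (rule exp_le)
  then have "exp 1 \<le> real n" using assms by linarith
  then have "1 \<le> ln (real n)" using assms by (simp add: ln_ge_iff)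
  then have "0 \<le> ln (ln (real n))" by simp
  then have "0 \<le> (real j - 1) * ln (ln (real n))" using assms by simp
  then show ?thesis unfolding p_rig_def by (intro divide_right_mono) auto
qed

lemma filterlim_min_at_top:
  fixes f g :: "'a \<Rightarrow> real"
  assumes "filterlim f at_top F" "filterlim g at_top F"
  shows "filterlim (\<lambda>x. min (f x) (g x)) at_top F"
  unfolding filterlim_at_top
proof
  fix Z
  have "\<forall>\<^sub>F x in F. Z \<le> f x" "\<forall>\<^sub>F x in F. Z \<le> g x" using assms by (auto simp: filterlim_at_top)
  then show "\<forall>\<^sub>F x in F. Z \<le> min (f x) (g x)" by eventually_elim simp
qed

text \<open>A possibly fast growing \<open>\<omega>\<close> is first capped by \<open>ln n\<close>.
  Expansion at the capped probability carries over to the given one because it is an increasing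
  property.\<close>

lemma prob_k_connected_tendsto_1:
  fixes m :: "nat \<Rightarrow> nat" and \<omega> :: "nat \<Rightarrow> real"
  assumes \<alpha>: "0 < \<alpha>" "\<alpha> \<le> 1" and m: "\<And>n. \<bar>real (m n) - real n powr \<alpha>\<bar> < 1"
    and w: "filterlim \<omega> at_top sequentially" and j: "1 \<le> j"
    and p01: "\<forall>\<^sub>F n in sequentially. p_rig \<omega> m j n \<in> {0..1}"
  shows "(\<lambda>n. measure_pmf.prob (random_intersection_graph n (m n) (p_rig \<omega> m j n))
            {G. k_connected k (with_proj G)}) \<longlonglongrightarrow> 1"
proof -
  define v where "v = (\<lambda>n. min (\<omega> n) (ln (real n)))"
  define p where "p = (\<lambda>n. (ln (real n) + v n) / real (m n))"
  define s where "s n = real n * exp (- 64) / 128" for n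
  let ?M = "\<lambda>n. incidence_pmf n (m n)"
  have "filterlim (\<lambda>n::nat. ln (real n)) at_top sequentially" by real_asymp
  then have v: "filterlim v at_top sequentially" unfolding v_def by (intro filterlim_min_at_top w)
  have vl: "v n \<le> ln (real n)" for n by (simp add: v_def)
  have pd: "p n = (ln (real n) + v n) / m n" for n by (simp add: p_def)
  note lim = prob_not_expanding_tendsto_0[OF \<alpha> m v vl pd, folded s_def]
  have "(\<lambda>n. measure_pmf.prob (?M n (p_rig \<omega> m j n)) {R. \<not> expanding n (m n) k (s n) R}) \<longlonglongrightarrow> 0"
  proof (rule real_tendsto_sandwich[where f = "\<lambda>_. 0" and
        h = "\<lambda>n. measure_pmf.prob (?M n (p n)) {R. \<not> expanding n (m n) k (s n) R}"])
    show "(\<lambda>n. measure_pmf.prob (?M n (p n)) {R. \<not> expanding n (m n) k (s n) R}) \<longlonglongrightarrow> 0"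
      by (rule lim(1))
    show "\<forall>\<^sub>F n in sequentially. measure_pmf.prob (?M n (p_rig \<omega> m j n)) {R. \<not> expanding n (m n) k (s n) R}
        \<le> measure_pmf.prob (?M n (p n)) {R. \<not> expanding n (m n) k (s n) R}"
      using p01 lim(2) eventually_ge_at_top[of 3]
    proof eventually_elim
      case (elim n)
      have "p n \<le> (ln (real n) + \<omega> n) / real (m n)"
        unfolding p_def by (intro divide_right_mono) (auto simp: v_def)
      also have "\<dots> \<le> p_rig \<omega> m j n" by (rule p_rig_ge[OF j]) (use elim in simp)
      finally have "measure_pmf.prob (?M n (p n)) {R. expanding n (m n) k (s n) R}
          \<le> measure_pmf.prob (?M n (p_rig \<omega> m j n)) {R. expanding n (m n) k (s n) R}"
        using elim by (intro prob_bernoulli_family_mono expanding_mono) auto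
      then show ?case by (simp add: prob_pmf_neg)
    qed
  qed auto
  then show ?thesis unfolding prob_random_intersection_graph
  proof (rule tendsto_prob_1_if_implied)
    show "\<forall>\<^sub>F n in sequentially. \<forall>R. expanding n (m n) k (s n) R \<longrightarrow>
        k_connected k (with_proj (intersection_graph n (m n) R))"
      using eventually_gt_at_top[of k] by eventually_elim (auto intro: k_connected_intersection_graph)
  qed
qed

lemma prob_has_hamilton_cycle_tendsto_1:
  fixes m :: "nat \<Rightarrow> nat" and \<omega> :: "nat \<Rightarrow> real"
  assumes \<alpha>: "0 < \<alpha>" "\<alpha> \<le> 1" and m: "\<And>n. \<bar>real (m n) - real n powr \<alpha>\<bar> < 1"
    and w: "filterlim \<omega> at_top sequentially" and j: "1 \<le> j"
    and p01: "\<forall>\<^sub>F n in sequentially. p_rig \<omega> m j n \<in> {0..1}"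
  shows "(\<lambda>n. measure_pmf.prob (random_intersection_graph n (m n) (p_rig \<omega> m j n))
            {G. has_hamilton_cycle (with_proj G)}) \<longlonglongrightarrow> 1"
proof -
  note as = number_of_features_asymptotics[OF \<alpha> m]
  define s where "s n = real n * exp (- 64) / 128" for n
  \<comment> \<open>This is the least round probability allowed by \<open>4 \<le> q * s * m\<close>.
    The rounds use at most \<open>6 * n * q = 24 * 128 * exp 64 / m\<close>, which is
    \<open>c / m\<close>; subtracting the constant \<open>c\<close> in \<open>v\<close> reserves
    this amount and still leaves \<open>v\<close> tending to infinity.\<close>
  define q where "q = (\<lambda>n. 4 / (s n * real (m n)))"
  define c where "c = (3072 * exp 64 :: real)"
  define v where "v = (\<lambda>n. min (\<omega> n) (ln (real n)) - c)"
  define p where "p = (\<lambda>n. (ln (real n) + v n) / real (m n))"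
  let ?M = "\<lambda>n. incidence_pmf n (m n)"
  let ?H = "\<lambda>n R. hamiltonian {..<n} (feature_adj n (m n) R)"
  have "filterlim (\<lambda>n::nat. ln (real n)) at_top sequentially" by real_asymp
  then have "filterlim (\<lambda>n. min (\<omega> n) (ln (real n))) at_top sequentially"
    by (intro filterlim_min_at_top w)
  then have v: "filterlim v at_top sequentially"
    unfolding v_def using filterlim_tendsto_add_at_top[OF tendsto_const[of "- c"]] by force
  have c: "0 \<le> c" by (simp add: c_def)
  have vl: "v n \<le> ln (real n)" for n using c by (simp add: v_def)
  have pd: "p n = (ln (real n) + v n) / m n" for n by (simp add: p_def)
  note lim = prob_not_expanding_tendsto_0(1)[OF \<alpha> m v vl pd, where k = 1, folded s_def]
    prob_not_expanding_tendsto_0(2)[OF \<alpha> m v vl pd]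
  have m1: "\<forall>\<^sub>F n in sequentially. 4 \<le> real (m n)"
    using as(2) unfolding filterlim_at_top by blast
  have s2: "\<forall>\<^sub>F n in sequentially. 2 \<le> s n"
  proof -
    have "filterlim (\<lambda>n. s n) at_top sequentially" unfolding s_def
    proof -
      have "filterlim (\<lambda>n. real n * c / 128) at_top sequentially" if "0 < c" for c :: real
        using that by real_asymp
      then show "filterlim (\<lambda>n. real n * exp (- 64) / 128) at_top sequentially" by simp
    qed
    then show ?thesis unfolding filterlim_at_top by blast
  qed
  have "(\<lambda>n. measure_pmf.prob (?M n (p_rig \<omega> m j n)) {R. \<not> ?H n R}) \<longlonglongrightarrow> 0"
  proof (rule real_tendsto_sandwich[where f = "\<lambda>_. 0" and
        h = "\<lambda>n. measure_pmf.prob (?M n (p n)) {R. \<not> expanding n (m n) 1 (s n) R} + 1 / 2 ^ n"])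
    show "\<forall>\<^sub>F n in sequentially. measure_pmf.prob (?M n (p_rig \<omega> m j n)) {R. \<not> ?H n R}
        \<le> measure_pmf.prob (?M n (p n)) {R. \<not> expanding n (m n) 1 (s n) R} + 1 / 2 ^ n"
      using p01 lim(2) m1 s2 eventually_ge_at_top[of 3]
    proof eventually_elim
      case (elim n)
      show ?case
      proof (rule prob_not_hamiltonian_le)
        have "2 * 4 \<le> s n * real (m n)" using elim by (intro mult_mono) auto
        then show "0 \<le> q n" "q n \<le> 1" "4 \<le> q n * s n * real (m n)"
          using elim by (auto simp: q_def field_simps)
        have "3 * (real n + 1) * q n \<le> 3 * (2 * real n) * q n"
          using elim \<open>0 \<le> q n\<close> by (intro mult_right_mono) auto
        also have "\<dots> = c / m n"
          using elim by (simp add: q_def s_def c_def exp_minus field_simps)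
        finally have "p n + 3 * (real n + 1) * q n \<le> p n + c / m n" by simp
        also have "\<dots> = (ln (real n) + min (\<omega> n) (ln (real n))) / m n"
          by (simp add: p_def v_def flip: add_divide_distrib)
        also have "\<dots> \<le> (ln (real n) + \<omega> n) / m n" by (intro divide_right_mono) auto
        also have "\<dots> \<le> p_rig \<omega> m j n" by (rule p_rig_ge[OF j]) (use elim in simp)
        finally show "p n + 3 * (real n + 1) * q n \<le> p_rig \<omega> m j n" .
      qed (use elim in auto)
    qed
    have "(\<lambda>n. 1 / 2 ^ n) \<longlonglongrightarrow> (0::real)" by real_asymp
    from tendsto_add[OF lim(1) this]
    show "(\<lambda>n. measure_pmf.prob (?M n (p n)) {R. \<not> expanding n (m n) 1 (s n) R} + 1 / 2 ^ n) \<longlonglongrightarrow> 0"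
      by simp
  qed auto
  then show ?thesis unfolding prob_random_intersection_graph
    by (rule tendsto_prob_1_if_implied) (intro always_eventually allI impI hamiltonian_imp_has_hamilton_cycle)
qed

text \<open>Common form of both statements below the threshold: \<open>P\<close> is any property
  forced by a vertex without features.\<close>

lemma prob_isolated_vertex_imp_tendsto_1:
  fixes m :: "nat \<Rightarrow> nat" and \<omega> :: "nat \<Rightarrow> real"
  assumes \<alpha>: "0 < \<alpha>" "\<alpha> \<le> 1" and m: "\<And>n. \<bar>real (m n) - real n powr \<alpha>\<bar> < 1"
    and w: "filterlim \<omega> at_bot sequentially"
    and p01: "\<forall>\<^sub>F n in sequentially. p_rig \<omega> m 1 n \<in> {0..1}"
    and P: "\<And>n R v. v < n \<Longrightarrow> feature_set (m n) R v = {} \<Longrightarrow> P (intersection_graph n (m n) R)"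
  shows "(\<lambda>n. measure_pmf.prob (random_intersection_graph n (m n) (p_rig \<omega> m 1 n)) {G. P G}) \<longlonglongrightarrow> 1"
  unfolding prob_random_intersection_graph
proof (rule tendsto_prob_1_if_implied)
  show "(\<lambda>n. measure_pmf.prob (incidence_pmf n (m n) (p_rig \<omega> m 1 n))
          {R. \<not> (\<exists>v<n. feature_set (m n) R v = {})}) \<longlonglongrightarrow> 0"
    by (rule prob_no_isolated_vertex_tendsto_0[OF \<alpha> m w _ p01]) (simp add: p_rig_def)
  show "\<forall>\<^sub>F n in sequentially. \<forall>R. (\<exists>v<n. feature_set (m n) R v = {}) \<longrightarrow>
      P (intersection_graph n (m n) R)"
    by (intro always_eventually allI impI) (use P in blast)
qed

theorem theorem8:
  fixes k :: nat and \<alpha> :: real and m :: "nat \<Rightarrow> nat" and \<omega> :: "nat \<Rightarrow> real"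
  assumes "1 \<le> k"
    and "0 < \<alpha>" and "\<alpha> \<le> 1"
    and "\<And>n. \<bar>real (m n) - real n powr \<alpha>\<bar> < 1"
  shows "(filterlim \<omega> at_bot sequentially \<and>
          (\<forall>\<^sub>F n in sequentially. p_rig \<omega> m 1 n \<in> {0..1}) \<longrightarrow>
            (\<lambda>n. measure_pmf.prob (random_intersection_graph n (m n) (p_rig \<omega> m 1 n))
                   {G. \<not> k_connected k (with_proj G)}) \<longlonglongrightarrow> 1)
       \<and> (filterlim \<omega> at_top sequentially \<and>
          (\<forall>\<^sub>F n in sequentially. p_rig \<omega> m k n \<in> {0..1}) \<longrightarrow>
            (\<lambda>n. measure_pmf.prob (random_intersection_graph n (m n) (p_rig \<omega> m k n))
                   {G. k_connected k (with_proj G)}) \<longlonglongrightarrow> 1)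
       \<and> (filterlim \<omega> at_bot sequentially \<and>
          (\<forall>\<^sub>F n in sequentially. p_rig \<omega> m 1 n \<in> {0..1}) \<longrightarrow>
            (\<lambda>n. measure_pmf.prob (random_intersection_graph n (m n) (p_rig \<omega> m 1 n))
                   {G. \<not> has_hamilton_cycle (with_proj G)}) \<longlonglongrightarrow> 1)
       \<and> (filterlim \<omega> at_top sequentially \<and>
          (\<forall>\<^sub>F n in sequentially. p_rig \<omega> m 2 n \<in> {0..1}) \<longrightarrow>
            (\<lambda>n. measure_pmf.prob (random_intersection_graph n (m n) (p_rig \<omega> m 2 n))
                   {G. has_hamilton_cycle (with_proj G)}) \<longlonglongrightarrow> 1)"
proof ((intro conjI impI; elim conjE), goal_cases)
  case 1
  then show ?case
    by (intro prob_isolated_vertex_imp_tendsto_1[OF assms(2-4)] isolated_not_k_connected assms(1))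
next
  case 2
  then show ?case by (intro prob_k_connected_tendsto_1[OF assms(2-4) _ assms(1)])
next
  case 3
  then show ?case
    by (intro prob_isolated_vertex_imp_tendsto_1[OF assms(2-4)] isolated_not_has_hamilton_cycle)
next
  case 4
  then show ?case by (intro prob_has_hamilton_cycle_tendsto_1[OF assms(2-4)]) simp_all
qed

end
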